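(* Let $G$ be a connected graph on $n$ vertices and $m$ edges. If $G\in\mathfrak{F}'$, then for every $\mathbb{T}$-gain graph $\Phi$ on $G$, $\lambda_1(A(\Phi))\le\rho(A(\Phi))\le3\lambda_1(A(\Phi))$.
   Context: Graphs are finite, simple and undirected. $\mathbb{T}=\{z\in\mathbb{C}:|z|=1\}$. A $\mathbb{T}$-gain on $G$ is a map $\varphi$ from oriented edges to $\mathbb{T}$ with $\varphi(\overrightarrow{e_{ts}})=\varphi(\overrightarrow{e_{st}})^{-1}$; $A(\Phi)$ for $\Phi=(G,\varphi)$ is the Hermitian matrix with $(s,t)$ entry $\varphi(\overrightarrow{e_{st}})$ if $v_s\sim v_t$, else $0$. $\lambda_1$ is the largest eigenvalue, $\rho$ the spectral radius. A rooted spanning tree $T$ with root $v_r$ induces the tree order ($v_x\le v_y$ iff $v_x$ is on the $T$-path from $v_r$ to $v_y$); $T$ is normal if adjacent vertices of $G$ are always comparable. Each non-tree edge creates a unique fundamental cycle with $T$. The sum of subgraphs is the subgraph consisting of all edges in at least one of them. A fundamental subgraph of $G$ w.r.t. $T$ is the sum of a maximal collection of fundamental cycles whose sum intersects $T$ in a subtree. $K_4'$ denotes $K_4$ or a subdivision of $K_4$. A fundamental subgraph whose set $S$ of fundamental cycles contains three cycles $C_1',C_2',C_3'$ with $C_1'+C_2'+C_3'$ equal to a $K_4'$ is $K_4'$-initiated; it has DEP if the remaining cycles $C_1,\dots,C_s$ of $S$ can be ordered $C_{k_1},\dots,C_{k_s}$ with $|E(C_{k_i})\setminus E(K_4'+C_{k_1}+\cdots+C_{k_{i-1}})|>1$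 for $i=1,\dots,s$. A non-$K_4'$-initiated fundamental subgraph built from cycles $C_1,\dots,C_s$ has DEP if they can be ordered $C_{k_1},\dots,C_{k_s}$ with $|E(C_{k_i})\setminus E(C_{k_1}+\cdots+C_{k_{i-1}})|>1$ for $i=2,\dots,s$. A connected graph has EDEP if all its fundamental subgraphs (of both types) with respect to a normal spanning tree $T$ have DEP; $\mathfrak{F}'$ is the collection of connected graphs with EDEP. *)

theory Defs
  imports "Jordan_Normal_Form.Spectral_Radius"
begin

(* Graphs: vertex set {0..<n}, edges are 2-element sets of vertices.
   Subgraphs (cycles, sums of cycles, K4-subdivisions) are represented by edge sets;
   the "sum" of subgraphs is the union of edge sets. *)

definition simple_graph :: "nat \<Rightarrow> nat set set \<Rightarrow> bool" where
  "simple_graph n E \<longleftrightarrow> E \<subseteq> {{x, y} | x y. x \<noteq> y \<and> x < n \<and> y < n}"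

definition vpath :: "nat set set \<Rightarrow> nat list \<Rightarrow> bool" where
  "vpath F xs \<longleftrightarrow> xs \<noteq> [] \<and> distinct xs \<and>
     (\<forall>i. Suc i < length xs \<longrightarrow> {xs ! i, xs ! Suc i} \<in> F)"

definition path_edges :: "nat list \<Rightarrow> nat set set" where
  "path_edges xs = {{xs ! i, xs ! Suc i} | i. Suc i < length xs}"

definition connected_on :: "nat set \<Rightarrow> nat set set \<Rightarrow> bool" where
  "connected_on V F \<longleftrightarrow> (\<forall>x\<in>V. \<forall>y\<in>V. \<exists>xs. vpath F xs \<and> hd xs = x \<and> last xs = y \<and> set xs \<subseteq> V)"

definition connected_graph :: "nat \<Rightarrow> nat set set \<Rightarrow> bool" where
  "connected_graph n E \<longleftrightarrow> simple_graph n E \<and> 0 < n \<and> connected_on {0..<n} E"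

definition acyclic_edges :: "nat set set \<Rightarrow> bool" where
  "acyclic_edges F \<longleftrightarrow> (\<forall>xs ys. vpath F xs \<and> vpath F ys \<and> hd xs = hd ys \<and> last xs = last ys \<longrightarrow> xs = ys)"

definition spanning_tree :: "nat \<Rightarrow> nat set set \<Rightarrow> nat set set \<Rightarrow> bool" where
  "spanning_tree n E T \<longleftrightarrow> T \<subseteq> E \<and> connected_on {0..<n} T \<and> acyclic_edges T"

definition tpath :: "nat set set \<Rightarrow> nat \<Rightarrow> nat \<Rightarrow> nat list" where
  "tpath T x y = (THE xs. vpath T xs \<and> hd xs = x \<and> last xs = y)"

definition tree_le :: "nat set set \<Rightarrow> nat \<Rightarrow> nat \<Rightarrow> nat \<Rightarrow> bool" where
  "tree_le T r x y \<longleftrightarrow> x \<in> set (tpath T r y)"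

definition normal_spanning_tree :: "nat \<Rightarrow> nat set set \<Rightarrow> nat set set \<Rightarrow> nat \<Rightarrow> bool" where
  "normal_spanning_tree n E T r \<longleftrightarrow> spanning_tree n E T \<and> r < n \<and>
     (\<forall>x y. {x, y} \<in> E \<longrightarrow> tree_le T r x y \<or> tree_le T r y x)"

definition nontree_edges :: "nat set set \<Rightarrow> nat set set \<Rightarrow> nat set set" where
  "nontree_edges E T = E - T"

definition fcyc :: "nat set set \<Rightarrow> nat set \<Rightarrow> nat set set" where
  "fcyc T e = insert e (\<Union>{path_edges (tpath T x y) | x y. e = {x, y}})"

(* sum of the fundamental cycles of a collection S (given by their non-tree edges) *)
definition fsum :: "nat set set \<Rightarrow> nat set set \<Rightarrow> nat set set" where
  "fsum T S = \<Union> (fcyc T ` S)"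

(* an edge set F \<subseteq> T forms a subtree (connected; acyclic is inherited from T) *)
definition subtree_edges :: "nat set set \<Rightarrow> bool" where
  "subtree_edges F \<longleftrightarrow> connected_on (\<Union>F) F \<and> acyclic_edges F"

definition fund_collection_ok :: "nat set set \<Rightarrow> nat set set \<Rightarrow> nat set set \<Rightarrow> bool" where
  "fund_collection_ok E T S \<longleftrightarrow> S \<subseteq> nontree_edges E T \<and> subtree_edges (fsum T S \<inter> T)"

(* maximal collections of fundamental cycles; their sums are the fundamental subgraphs *)
definition maximal_fund_collection :: "nat set set \<Rightarrow> nat set set \<Rightarrow> nat set set \<Rightarrow> bool" where
  "maximal_fund_collection E T S \<longleftrightarrow> fund_collection_ok E T S \<and>
     (\<forall>S'. S \<subset> S' \<longrightarrow> \<not> fund_collection_ok E T S')"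

definition K4_subdivision :: "nat set set \<Rightarrow> bool" where
  "K4_subdivision H \<longleftrightarrow> (\<exists>(a :: nat \<Rightarrow> nat) (P :: nat \<Rightarrow> nat \<Rightarrow> nat list).
     inj_on a {0..<4} \<and>
     (\<forall>i j. i < j \<and> j < 4 \<longrightarrow> vpath H (P i j) \<and> hd (P i j) = a i \<and> last (P i j) = a j) \<and>
     (\<forall>i j k l. i < j \<and> j < 4 \<and> k < l \<and> l < 4 \<and> (i, j) \<noteq> (k, l) \<longrightarrow>
        set (P i j) \<inter> set (P k l) \<subseteq> {a i, a j} \<inter> {a k, a l}) \<and>
     H = \<Union>{path_edges (P i j) | i j. i < j \<and> j < 4})"

definition K4_initiated_by :: "nat set set \<Rightarrow> nat set set \<Rightarrow> nat set \<Rightarrow> nat set \<Rightarrow> nat set \<Rightarrow> bool" where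
  "K4_initiated_by T S e1 e2 e3 \<longleftrightarrow> e1 \<in> S \<and> e2 \<in> S \<and> e3 \<in> S \<and>
     e1 \<noteq> e2 \<and> e1 \<noteq> e3 \<and> e2 \<noteq> e3 \<and> K4_subdivision (fcyc T e1 \<union> fcyc T e2 \<union> fcyc T e3)"

definition K4_initiated :: "nat set set \<Rightarrow> nat set set \<Rightarrow> bool" where
  "K4_initiated T S \<longleftrightarrow> (\<exists>e1 e2 e3. K4_initiated_by T S e1 e2 e3)"

definition DEP :: "nat set set \<Rightarrow> nat set set \<Rightarrow> bool" where
  "DEP T S \<longleftrightarrow>
    (if K4_initiated T S then
       (\<exists>e1 e2 e3 ks. K4_initiated_by T S e1 e2 e3 \<and>
          distinct ks \<and> set ks = S - {e1, e2, e3} \<and>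
          (\<forall>i < length ks. card (fcyc T (ks ! i) -
              (fcyc T e1 \<union> fcyc T e2 \<union> fcyc T e3 \<union> fsum T (set (take i ks)))) > 1))
     else
       (\<exists>ks. distinct ks \<and> set ks = S \<and>
          (\<forall>i < length ks. 0 < i \<longrightarrow> card (fcyc T (ks ! i) - fsum T (set (take i ks))) > 1)))"

definition EDEP :: "nat \<Rightarrow> nat set set \<Rightarrow> bool" where
  "EDEP n E \<longleftrightarrow> connected_graph n E \<and>
     (\<exists>T r. normal_spanning_tree n E T r \<and>
        (\<forall>S. maximal_fund_collection E T S \<longrightarrow> DEP T S))"

(* T-gain: phi s t is the gain of the oriented edge from v_s to v_t *)
definition T_gain :: "nat set set \<Rightarrow> (nat \<Rightarrow> nat \<Rightarrow> complex) \<Rightarrow> bool" where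
  "T_gain E \<phi> \<longleftrightarrow> (\<forall>s t. {s, t} \<in> E \<longrightarrow> cmod (\<phi> s t) = 1 \<and> \<phi> t s = inverse (\<phi> s t))"

definition gain_adj :: "nat \<Rightarrow> nat set set \<Rightarrow> (nat \<Rightarrow> nat \<Rightarrow> complex) \<Rightarrow> complex mat" where
  "gain_adj n E \<phi> = mat n n (\<lambda>(s, t). if {s, t} \<in> E then \<phi> s t else 0)"

(* largest eigenvalue of a (Hermitian) matrix: the largest real eigenvalue *)
definition lambda1 :: "complex mat \<Rightarrow> real" where
  "lambda1 A = Max {x :: real. eigenvalue A (complex_of_real x)}"

end

theory Submission
  imports Defs
begin

text \<open>A proper 4-colouring of \<open>G\<close> already gives the spectral bound: if colours are mapped to signs
  by a random balanced pattern, two different colours receive signs with average product \<open>-1/3\<close>,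
  so switching an eigenvector of a negative eigenvalue \<open>\<mu>\<close> produces some vector with Rayleigh
  quotient at least \<open>- \<mu> / 3\<close>.

  A graph with EDEP is 3-degenerate, hence 4-colourable. Indeed DEP says that, up to three initial
  cycles, every fundamental cycle contains a tree edge missed by its predecessors. For a vertex
  set \<open>W\<close> and a non-tree edge inside \<open>W\<close> from \<open>u\<close> down to \<open>v\<close>, record the vertices of \<open>W\<close>
  on the tree path from \<open>u\<close> (excluded) to \<open>v\<close>. A fresh tree edge forces a fresh recorded vertex,
  and a highest vertex of \<open>W\<close> in a component is never recorded; counting gives at most \<open>|W|\<close>
  non-tree edges inside \<open>W\<close> next to at most \<open>|W| - 1\<close> tree edges, hence a vertex of degree
  at most 3.\<close>

section \<open>Rayleigh quotients of self-adjoint matrices\<close>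

lemma mat_adjoint_index:
  assumes "A \<in> carrier_mat n n" "i < n" "j < n"
  shows "mat_adjoint A $$ (i, j) = conjugate (A $$ (j, i))"
  using assms unfolding mat_adjoint_def by (simp add: mat_of_rows_index)

lemma cscalar_prod_mult_mat_vec:
  fixes A :: "complex mat"
  assumes A: "A \<in> carrier_mat n n" and v: "v \<in> carrier_vec n" and w: "w \<in> carrier_vec n"
  shows "(A *\<^sub>v v) \<bullet>c w = (\<Sum>i<n. \<Sum>j<n. A $$ (i, j) * v $ j * cnj (w $ i))"
  using assms
  by (auto simp: scalar_prod_def sum_distrib_right lessThan_atLeast0 intro!: sum.cong)

lemma self_adjoint_cscalar_prod:
  fixes A :: "complex mat"
  assumes A: "A \<in> carrier_mat n n" and herm: "mat_adjoint A = A"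
    and v: "v \<in> carrier_vec n" and w: "w \<in> carrier_vec n"
  shows "(A *\<^sub>v v) \<bullet>c w = v \<bullet>c (A *\<^sub>v w)"
proof -
  have cnj: "cnj (A $$ (i, j)) = A $$ (j, i)" if "i < n" "j < n" for i j
    using mat_adjoint_index[OF A that(2,1)] herm by simp
  have "v \<bullet>c (A *\<^sub>v w) = (\<Sum>j<n. \<Sum>i<n. v $ j * cnj (A $$ (j, i) * w $ i))"
    using assms by (auto simp: scalar_prod_def sum_distrib_left lessThan_atLeast0 intro!: sum.cong)
  also have "\<dots> = (\<Sum>i<n. \<Sum>j<n. v $ j * cnj (A $$ (j, i) * w $ i))"
    by (rule sum.swap)
  also have "\<dots> = (\<Sum>i<n. \<Sum>j<n. A $$ (i, j) * v $ j * cnj (w $ i))"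
    by (intro sum.cong refl) (simp add: cnj)
  finally show ?thesis
    using cscalar_prod_mult_mat_vec[OF A v w] by simp
qed

lemma Re_cscalar_prod_self:
  "Re (v \<bullet>c v) = (\<Sum>i<dim_vec v. (cmod (v $ i))\<^sup>2)"
  unfolding scalar_prod_def cmod_power2
  by (auto simp: lessThan_atLeast0 power2_eq_square intro!: sum.cong)

lemma Re_cscalar_prod_self_nonneg: "0 \<le> Re (v \<bullet>c v)"
  unfolding Re_cscalar_prod_self by (intro sum_nonneg) auto

lemma Re_cscalar_prod_self_pos:
  assumes "v \<in> carrier_vec n" "v \<noteq> 0\<^sub>v n"
  shows "0 < Re (v \<bullet>c v)"
proof -
  obtain i where "i < n" "v $ i \<noteq> 0"
    using assms by (metis carrier_vecD eq_vecI index_zero_vec)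
  then show ?thesis
    unfolding Re_cscalar_prod_self using assms(1)
    by (intro sum_pos2[of _ i]) auto
qed

lemma Re_cscalar_prod_le:
  fixes v w :: "complex vec"
  assumes v: "v \<in> carrier_vec n" and w: "w \<in> carrier_vec n"
  shows "2 * Re (v \<bullet>c w) \<le> Re (v \<bullet>c v) + Re (w \<bullet>c w)"
proof -
  have "2 * Re (a * cnj b) \<le> Re (a * cnj a) + Re (b * cnj b)" for a b
    using sum_squares_ge_zero[of "Re a - Re b" "Im a - Im b"] by (simp add: algebra_simps)
  then have "(\<Sum>i<n. 2 * Re (v $ i * cnj (w $ i)))
      \<le> (\<Sum>i<n. Re (v $ i * cnj (v $ i)) + Re (w $ i * cnj (w $ i)))"
    by (intro sum_mono) auto
  moreover have "Re (a \<bullet>c b) = (\<Sum>i<n. Re (a $ i * cnj (b $ i)))"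
    if "a \<in> carrier_vec n" "b \<in> carrier_vec n" for a b :: "complex vec"
    using that by (auto simp: scalar_prod_def lessThan_atLeast0 intro!: sum.cong)
  ultimately show ?thesis
    using v w by (simp add: sum.distrib sum_distrib_left)
qed

text \<open>Applied to powers: an entry bound that is uniform in \<open>k\<close> becomes a bound on
  the squared norm of the \<open>k\<close>-th power applied to \<open>x\<close> that does not depend
  on \<open>k\<close>.\<close>

lemma norm_bound_mult_vec:
  assumes A: "A \<in> carrier_mat n n" and x: "x \<in> carrier_vec n" and c: "norm_bound A c"
  shows "Re ((A *\<^sub>v x) \<bullet>c (A *\<^sub>v x)) \<le> n * (c * (\<Sum>j<n. cmod (x $ j)))\<^sup>2"
proof -
  have "cmod ((A *\<^sub>v x) $ i) \<le> c * (\<Sum>j<n. cmod (x $ j))" if i: "i < n" for i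
  proof -
    have "(A *\<^sub>v x) $ i = (\<Sum>j<n. A $$ (i, j) * x $ j)"
      using A x i by (auto simp: scalar_prod_def lessThan_atLeast0 intro!: sum.cong)
    also have "cmod \<dots> \<le> (\<Sum>j<n. c * cmod (x $ j))"
      using A c i unfolding norm_bound_def
      by (intro sum_norm_le) (auto simp: norm_mult intro!: mult_right_mono)
    finally show ?thesis by (simp add: sum_distrib_left)
  qed
  then have "(\<Sum>i<n. (cmod ((A *\<^sub>v x) $ i))\<^sup>2) \<le> (\<Sum>i<n. (c * (\<Sum>j<n. cmod (x $ j)))\<^sup>2)"
    by (intro sum_mono power_mono) auto
  then show ?thesis using A unfolding Re_cscalar_prod_self by simp
qed

text \<open>Convexity makes the increments nondecreasing, so a positive first increment would force
  linear growth past \<open>M\<close>.\<close>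

lemma convex_bounded_seq_le:
  fixes b :: "nat \<Rightarrow> real"
  assumes convex: "\<And>k. 2 * b (Suc k) \<le> b k + b (Suc (Suc k))" and bound: "\<And>k. b k \<le> M"
  shows "b 1 \<le> b 0"
proof (rule ccontr)
  assume "\<not> b 1 \<le> b 0"
  then have d: "b 1 - b 0 > 0" by simp
  have inc: "b (Suc k) - b k \<ge> b 1 - b 0" for k
  proof (induction k)
    case (Suc k)
    then show ?case using convex[of k] by simp
  qed simp
  have "b k \<ge> b 0 + real k * (b 1 - b 0)" for k
  proof (induction k)
    case (Suc k)
    then show ?case using inc[of k] by (simp add: algebra_simps)
  qed simp
  moreover obtain k where "real k * (b 1 - b 0) > M - b 0"
    using reals_Archimedean3[OF d] by blast
  ultimately show False using bound[of k] by (smt (verit))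
qed

text \<open>For self-adjoint \<open>A\<close> the sequence \<open>|A\<^sup>k x|\<^sup>2\<close> is convex in \<open>k\<close>; spectral
  radius below 1 makes it bounded, so it cannot increase.\<close>

lemma self_adjoint_contraction:
  fixes A :: "complex mat"
  assumes A: "A \<in> carrier_mat n n" and herm: "mat_adjoint A = A"
    and sr: "spectral_radius A < 1" and x: "x \<in> carrier_vec n"
  shows "Re ((A *\<^sub>v x) \<bullet>c x) \<le> Re (x \<bullet>c x)"
proof -
  define v where "v k = (A ^\<^sub>m k) *\<^sub>v x" for k
  define b where "b k = Re (v k \<bullet>c v k)" for k
  have Ak: "A ^\<^sub>m k \<in> carrier_mat n n" for k using A by simp
  have vc: "v k \<in> carrier_vec n" for k
    unfolding v_def using Ak[of k] x by simp
  \<comment> \<open>\<open>A ^\<^sub>m Suc k\<close> carries its new factor on the right; moving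
    \<open>A\<close> past the power yields the recursion
    \<open>v (Suc k) = A *\<^sub>v v k\<close>.\<close>
  have comm: "(A ^\<^sub>m k) *\<^sub>v (A *\<^sub>v y) = A *\<^sub>v ((A ^\<^sub>m k) *\<^sub>v y)" if "y \<in> carrier_vec n" for k y
    using that
  proof (induction k arbitrary: y)
    case (Suc k)
    have Ay: "A *\<^sub>v y \<in> carrier_vec n" using A Suc.prems by simp
    have "(A ^\<^sub>m Suc k) *\<^sub>v (A *\<^sub>v y) = (A ^\<^sub>m k) *\<^sub>v (A *\<^sub>v (A *\<^sub>v y))"
      using assoc_mult_mat_vec[OF Ak[of k] A Ay] by simp
    also have "\<dots> = A *\<^sub>v ((A ^\<^sub>m k) *\<^sub>v (A *\<^sub>v y))"
      by (rule Suc.IH[OF Ay])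
    also have "\<dots> = A *\<^sub>v ((A ^\<^sub>m Suc k) *\<^sub>v y)"
      using assoc_mult_mat_vec[OF Ak[of k] A Suc.prems] by simp
    finally show ?case .
  qed (use A in simp)
  have vSuc: "v (Suc k) = A *\<^sub>v v k" for k
    unfolding v_def using assoc_mult_mat_vec[OF Ak[of k] A x] comm[OF x, of k] by simp
  have convex: "2 * b (Suc k) \<le> b k + b (Suc (Suc k))" for k
  proof -
    have "v (Suc k) \<bullet>c v (Suc k) = v k \<bullet>c v (Suc (Suc k))"
      using self_adjoint_cscalar_prod[OF A herm vc[of k] vc[of "Suc k"]] vSuc by simp
    then show ?thesis
      using Re_cscalar_prod_le[OF vc[of k] vc[of "Suc (Suc k)"]] unfolding b_def by simp
  qed
  \<comment> \<open>The Jordan normal form provides one entry bound \<open>c\<close> for all powers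
    at once.\<close>
  obtain c where c: "\<And>k. norm_bound (A ^\<^sub>m k) c"
    using spectral_radius_jnf_norm_bound_less_1_upper_triangular[OF A sr] by blast
  have bound: "b k \<le> n * (c * (\<Sum>j<n. cmod (x $ j)))\<^sup>2" for k
    using norm_bound_mult_vec[OF Ak x c] by (simp add: b_def v_def)
  have "b 1 \<le> b 0"
    using convex bound by (rule convex_bounded_seq_le)
  moreover have "v 0 = x" "v 1 = A *\<^sub>v x"
    using A x vSuc[of 0] by (simp_all add: v_def)
  ultimately show ?thesis
    using Re_cscalar_prod_le[OF vc[of 1] vc[of 0]] unfolding b_def by simp
qed

lemma self_adjoint_eigenvalue_real:
  fixes A :: "complex mat"
  assumes A: "A \<in> carrier_mat n n" and herm: "mat_adjoint A = A" and k: "eigenvalue A k"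
  shows "k = complex_of_real (Re k)"
proof -
  obtain v where v: "v \<in> carrier_vec n" "v \<noteq> 0\<^sub>v n" "A *\<^sub>v v = k \<cdot>\<^sub>v v"
    using k A unfolding eigenvalue_def eigenvector_def by auto
  have "k * (v \<bullet>c v) = cnj k * (v \<bullet>c v)"
    using self_adjoint_cscalar_prod[OF A herm v(1) v(1)] v
    by (simp add: conjugate_smult_vec)
  moreover have "v \<bullet>c v \<noteq> 0"
    using Re_cscalar_prod_self_pos[OF v(1,2)] by auto
  ultimately have "k = cnj k" by simp
  then show ?thesis by (metis Reals_cnj_iff of_real_Re)
qed

text \<open>Adding the spectral radius \<open>c\<close> makes all eigenvalues nonnegative, and
  scaling by \<open>1 / (m + c + e)\<close> moves them into the half-open unit interval. The
  contraction lemma applies to the resulting \<open>B\<close>; undoing the affine change and letting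
  \<open>e\<close> tend to 0 gives the bound.\<close>

lemma self_adjoint_rayleigh:
  fixes A :: "complex mat"
  assumes A: "A \<in> carrier_mat n n" and herm: "mat_adjoint A = A"
    and le: "\<And>k. eigenvalue A (complex_of_real k) \<Longrightarrow> k \<le> m"
    and x: "x \<in> carrier_vec n"
  shows "Re ((A *\<^sub>v x) \<bullet>c x) \<le> m * Re (x \<bullet>c x)"
proof (cases "n = 0")
  case True
  then show ?thesis using A x by (simp add: scalar_prod_def)
next
  case False
  then have n: "n > 0" by simp
  define c where "c = spectral_radius A"
  have sr: "cmod k \<le> c" if "eigenvalue A k" for k
    using spectral_radius_mem_max(2)[OF A n] that unfolding c_def spectrum_def by auto
  obtain k0 where k0: "eigenvalue A k0"
    using spectrum_non_empty[OF A n] unfolding spectrum_def by auto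
  \<comment> \<open>Some eigenvalue \<open>k0\<close> exists; it is real and lies between
    \<open>- c\<close> and \<open>m\<close>. Hence the denominator of \<open>s\<close> below is
    positive.\<close>
  have "m + c \<ge> 0"
    using le[of "Re k0"] sr[OF k0] k0 self_adjoint_eigenvalue_real[OF A herm k0]
      abs_Re_le_cmod[of k0] by simp
  have lim: "Re ((A *\<^sub>v x) \<bullet>c x) \<le> m * Re (x \<bullet>c x) + e * Re (x \<bullet>c x)" if e: "e > 0" for e
  proof -
    define s where "s = 1 / (m + c + e)"
    have s: "s > 0" unfolding s_def using e \<open>m + c \<ge> 0\<close> by simp
    define B where "B = complex_of_real s \<cdot>\<^sub>m (A + complex_of_real c \<cdot>\<^sub>m 1\<^sub>m n)"
    have B: "B \<in> carrier_mat n n" unfolding B_def using A by simp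
    have Bv: "B *\<^sub>v v = complex_of_real s \<cdot>\<^sub>v (A *\<^sub>v v + complex_of_real c \<cdot>\<^sub>v v)"
      if v: "v \<in> carrier_vec n" for v
      unfolding B_def using A that
      by (intro eq_vecI)
        (auto simp: scalar_prod_def sum_distrib_left sum.distrib algebra_simps row_def
          sum.delta if_distrib[of "\<lambda>y. _ * y"] cong: if_cong)
    have Bherm: "mat_adjoint B = B"
    proof (rule eq_matI)
      fix i j assume ij: "i < dim_row B" "j < dim_col B"
      then have "A $$ (i, j) = cnj (A $$ (j, i))"
        using mat_adjoint_index[OF A, of i j] herm B by simp
      then show "mat_adjoint B $$ (i, j) = B $$ (i, j)"
        using ij A B mat_adjoint_index[OF B, of i j] by (simp add: B_def)
    qed (use B in \<open>auto simp: mat_adjoint_def\<close>)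
    have "cmod k < 1" if kB: "eigenvalue B k" for k
    proof -
      obtain v where v: "v \<in> carrier_vec n" "v \<noteq> 0\<^sub>v n" "B *\<^sub>v v = k \<cdot>\<^sub>v v"
        using kB B unfolding eigenvalue_def eigenvector_def by auto
      have kr: "k = complex_of_real (Re k)"
        by (rule self_adjoint_eigenvalue_real[OF B Bherm kB])
      have "A *\<^sub>v v = complex_of_real (Re k / s - c) \<cdot>\<^sub>v v"
      proof (rule eq_vecI)
        fix i assume i: "i < dim_vec (complex_of_real (Re k / s - c) \<cdot>\<^sub>v v)"
        then have "complex_of_real s * ((A *\<^sub>v v) $ i + complex_of_real c * v $ i) = k * v $ i"
          using Bv[OF v(1)] v A
          by (metis (no_types, lifting) carrier_matD(1) carrier_vecD dim_mult_mat_vec index_add_vec(1)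
              index_smult_vec index_add_vec(2))
        then show "(A *\<^sub>v v) $ i = (complex_of_real (Re k / s - c) \<cdot>\<^sub>v v) $ i"
          using s i kr by (simp add: field_simps)
      qed (use A v in auto)
      then have ev: "eigenvalue A (complex_of_real (Re k / s - c))"
        using v A unfolding eigenvalue_def eigenvector_def by auto
      have "Re k / s - c \<le> m" "Re k / s \<ge> 0"
        using le[OF ev] sr[OF ev] by (auto simp del: of_real_diff of_real_divide)
      moreover have "m + c + e = 1 / s" by (simp add: s_def)
      ultimately have "Re k \<ge> 0" "Re k / s < 1 / s"
        using s e by (auto simp: zero_le_divide_iff)
      then have "Re k \<ge> 0" "Re k < 1"
        using s by (auto simp: divide_less_cancel)
      then show ?thesis using kr by (metis abs_of_nonneg norm_of_real)
    qed
    then have "spectral_radius B < 1"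
      using spectral_radius_mem_max(1)[OF B n] unfolding spectrum_def by auto
    then have "Re ((B *\<^sub>v x) \<bullet>c x) \<le> Re (x \<bullet>c x)"
      by (rule self_adjoint_contraction[OF B Bherm _ x])
    moreover have "(B *\<^sub>v x) \<bullet>c x = complex_of_real s * ((A *\<^sub>v x) \<bullet>c x + complex_of_real c * (x \<bullet>c x))"
      unfolding Bv[OF x] using A x by (simp add: add_scalar_prod_distrib[of _ n])
    ultimately have "s * (Re ((A *\<^sub>v x) \<bullet>c x) + c * Re (x \<bullet>c x)) \<le> Re (x \<bullet>c x)"
      by simp
    then show ?thesis
      using s unfolding s_def by (simp add: field_simps)
  qed
  show ?thesis
  proof (rule field_le_epsilon)
    fix e :: real assume e: "e > 0"
    let ?y = "Re (x \<bullet>c x)"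
    have y: "?y \<ge> 0" by (rule Re_cscalar_prod_self_nonneg)
    \<comment> \<open>The \<open>+ 1\<close> keeps the chosen slack positive even when
      \<open>x\<close> is the zero vector.\<close>
    then have "e / (?y + 1) * ?y \<le> e"
      using e by (simp add: field_simps)
    then show "Re ((A *\<^sub>v x) \<bullet>c x) \<le> m * ?y + e"
      using lim[of "e / (?y + 1)"] e y by simp
  qed
qed

section \<open>The largest eigenvalue of a self-adjoint matrix\<close>

lemma lambda1_mem_max:
  assumes A: "A \<in> carrier_mat n n" and n: "n > 0" and herm: "mat_adjoint A = A"
  shows "eigenvalue A (complex_of_real (lambda1 A))"
    and "eigenvalue A (complex_of_real x) \<Longrightarrow> x \<le> lambda1 A"
proof -
  let ?S = "{x :: real. eigenvalue A (complex_of_real x)}"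
  \<comment> \<open>The \<open>Max\<close> in \<open>lambda1\<close> is meaningful because the
    spectrum is finite and nonempty, and all its elements are real.\<close>
  have "finite (complex_of_real ` ?S)"
    by (rule finite_subset[OF _ card_finite_spectrum(1)[OF A]]) (auto simp: spectrum_def)
  then have fin: "finite ?S"
    by (rule finite_imageD) (auto intro: inj_onI)
  obtain k where "eigenvalue A k"
    using spectrum_non_empty[OF A n] unfolding spectrum_def by auto
  then have ne: "?S \<noteq> {}"
    using self_adjoint_eigenvalue_real[OF A herm] by (metis (mono_tags) empty_iff mem_Collect_eq)
  show "eigenvalue A (complex_of_real (lambda1 A))"
    using Max_in[OF fin ne] unfolding lambda1_def by simp
  show "eigenvalue A (complex_of_real x) \<Longrightarrow> x \<le> lambda1 A"
    using Max_ge[OF fin, of x] unfolding lambda1_def by simp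
qed

lemma lambda1_le_spectral_radius:
  assumes A: "A \<in> carrier_mat n n" and n: "n > 0" and herm: "mat_adjoint A = A"
  shows "lambda1 A \<le> spectral_radius A"
proof -
  have "cmod (complex_of_real (lambda1 A)) \<le> spectral_radius A"
    using spectral_radius_mem_max(2)[OF A n] lambda1_mem_max(1)[OF assms]
    unfolding spectrum_def by blast
  then show ?thesis by simp
qed

section \<open>Balanced sign patterns on four colours\<close>

definition balanced_sign :: "nat \<Rightarrow> nat \<Rightarrow> real" where
  "balanced_sign k c = (if c = 0 \<or> c = k then 1 else - 1)"

text \<open>The patterns for \<open>k = 1, 2, 3\<close> are the non-constant rows of a Hadamard
  matrix of order 4. Its distinct columns are orthogonal; the missing all-ones row accounts for 1,
  which leaves \<open>- 1\<close>.\<close>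

lemma sum_balanced_sign:
  assumes "a < 4" "b < 4" "a \<noteq> b"
  shows "(\<Sum>k\<in>{1,2,3}. balanced_sign k a * balanced_sign k b) = - 1"
proof -
  have "a \<in> {0,1,2,3}" "b \<in> {0,1,2,3}" using assms by auto
  then show ?thesis using assms(3) by (auto simp: balanced_sign_def)
qed

text \<open>The three sign patterns average an entry \<open>a\<^sub>i\<^sub>j\<close> with differently coloured indices to
  \<open>- a\<^sub>i\<^sub>j / 3\<close>, so an eigenvector for a negative eigenvalue \<open>\<mu>\<close> yields a vector with
  Rayleigh quotient at least \<open>- \<mu> / 3\<close>.\<close>

lemma spectral_radius_le_lambda1_of_four_colouring:
  assumes A: "A \<in> carrier_mat n n" and n: "n > 0" and herm: "mat_adjoint A = A"
    and col: "\<And>i. c i < (4 :: nat)"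
    and proper: "\<And>i j. i < n \<Longrightarrow> j < n \<Longrightarrow> c i = c j \<Longrightarrow> A $$ (i, j) = 0"
  shows "spectral_radius A \<le> 3 * lambda1 A"
proof -
  obtain k where k: "eigenvalue A k" "spectral_radius A = cmod k"
    using spectral_radius_mem_max(1)[OF A n] unfolding spectrum_def by auto
  define m where "m = Re k"
  have km: "k = complex_of_real m"
    unfolding m_def by (rule self_adjoint_eigenvalue_real[OF A herm k(1)])
  have m: "m \<le> lambda1 A"
    using lambda1_mem_max(2)[OF A n herm] k(1) km by simp
  show ?thesis
  proof (cases "m \<ge> 0")
    case True
    \<comment> \<open>Here the spectral radius is \<open>m\<close> itself, so
      \<open>lambda1 A\<close> is nonnegative and the factor 3 only enlarges it.\<close>
    then show ?thesis using m k(2) km by simp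
  next
    case False
    obtain x where x: "x \<in> carrier_vec n" "x \<noteq> 0\<^sub>v n" "A *\<^sub>v x = k \<cdot>\<^sub>v x"
      using k(1) A unfolding eigenvalue_def eigenvector_def by auto
    define s where "s l i = balanced_sign l (c i)" for l i
    define y where "y l = vec n (\<lambda>i. complex_of_real (s l i) * x $ i)" for l
    have yc: "y l \<in> carrier_vec n" for l unfolding y_def by simp
    have norm_y: "Re (y l \<bullet>c y l) = Re (x \<bullet>c x)" for l
      using x(1) unfolding Re_cscalar_prod_self y_def
      by (auto simp: s_def balanced_sign_def norm_mult intro!: sum.cong)
    have Ay: "(A *\<^sub>v y l) \<bullet>c y l
        = (\<Sum>i<n. \<Sum>j<n. A $$ (i, j) * x $ j * cnj (x $ i) * complex_of_real (s l i * s l j))" for l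
      unfolding cscalar_prod_mult_mat_vec[OF A yc yc]
      by (intro sum.cong refl) (simp add: y_def)
    have entry: "(\<Sum>l\<in>{1,2,3}. A $$ (i, j) * x $ j * cnj (x $ i) * complex_of_real (s l i * s l j))
        = - (A $$ (i, j) * x $ j * cnj (x $ i))" if "i < n" "j < n" for i j
    proof (cases "c i = c j")
      case True
      \<comment> \<open>Equal colours, in particular \<open>i = j\<close>: the entry of
        \<open>A\<close> vanishes and both sides are 0.\<close>
      then show ?thesis using proper[OF that] by simp
    next
      case False
      then have "(\<Sum>l\<in>{1,2,3}. s l i * s l j) = - 1"
        unfolding s_def by (rule sum_balanced_sign[OF col col])
      then have "(\<Sum>l\<in>{1,2,3}. complex_of_real (s l i * s l j)) = - 1"
        unfolding of_real_sum[symmetric] by simp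
      then show ?thesis unfolding sum_distrib_left[symmetric] by simp
    qed
    have "(\<Sum>l\<in>{1,2,3}. (A *\<^sub>v y l) \<bullet>c y l)
        = (\<Sum>i<n. \<Sum>j<n. \<Sum>l\<in>{1,2,3}. A $$ (i, j) * x $ j * cnj (x $ i) * complex_of_real (s l i * s l j))"
      unfolding Ay
      by (rule trans[OF sum.swap]) (intro sum.cong refl sum.swap)
    also have "\<dots> = - ((A *\<^sub>v x) \<bullet>c x)"
      unfolding cscalar_prod_mult_mat_vec[OF A x(1) x(1)] sum_negf[symmetric]
      using entry by (intro sum.cong refl) auto
    also have "\<dots> = - (complex_of_real m * (x \<bullet>c x))"
      using x km by simp
    finally have "- m * Re (x \<bullet>c x) = (\<Sum>l\<in>{1,2,3}. Re ((A *\<^sub>v y l) \<bullet>c y l))"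
      by (simp add: Re_sum[symmetric] del: sum.insert Re_sum)
    \<comment> \<open>Signs do not change norms, so all three summands obey the same Rayleigh
      bound.\<close>
    also have "\<dots> \<le> (\<Sum>l\<in>{1::nat,2,3}. lambda1 A * Re (x \<bullet>c x))"
    proof (rule sum_mono)
      fix l
      show "Re ((A *\<^sub>v y l) \<bullet>c y l) \<le> lambda1 A * Re (x \<bullet>c x)"
        using self_adjoint_rayleigh[OF A herm lambda1_mem_max(2)[OF A n herm] yc[of l]]
        by (simp add: norm_y)
    qed
    finally have "- m * Re (x \<bullet>c x) \<le> (3 * lambda1 A) * Re (x \<bullet>c x)" by simp
    then have "- m \<le> 3 * lambda1 A"
      using Re_cscalar_prod_self_pos[OF x(1,2)] by (simp only: mult_le_cancel_right_pos)
    then show ?thesis using False k(2) km by simp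
  qed
qed

text \<open>For a gain of modulus 1 the inverse is the conjugate, so the rule for reversed edges is
  Hermitian symmetry.\<close>

lemma T_gain_self_adjoint:
  assumes "T_gain E \<phi>"
  shows "mat_adjoint (gain_adj n E \<phi>) = gain_adj n E \<phi>"
proof (rule eq_matI)
  have A: "gain_adj n E \<phi> \<in> carrier_mat n n" by (simp add: gain_adj_def)
  fix i j assume ij: "i < dim_row (gain_adj n E \<phi>)" "j < dim_col (gain_adj n E \<phi>)"
  have "\<phi> i j = cnj (\<phi> j i)" if "{i, j} \<in> E"
  proof -
    have "cmod (\<phi> j i) = 1" "\<phi> i j = inverse (\<phi> j i)"
      using assms that unfolding T_gain_def by (metis insert_commute)+
    then show ?thesis
      by (simp add: inverse_eq_divide divide_conv_cnj)
  qed
  then show "mat_adjoint (gain_adj n E \<phi>) $$ (i, j) = gain_adj n E \<phi> $$ (i, j)"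
    using ij A mat_adjoint_index[OF A, of i j] by (auto simp: gain_adj_def insert_commute)
qed (auto simp: mat_adjoint_def gain_adj_def)

section \<open>Sparse graphs and paths\<close>

text \<open>Greedy colouring: remove a vertex with at most three neighbours, colour the rest by
  induction, and give the vertex a colour missing among its neighbours. The degree condition ranges
  over all subsets so that it survives the removal.\<close>

lemma degenerate_four_colouring:
  assumes "finite V"
    and "\<And>W. W \<subseteq> V \<Longrightarrow> W \<noteq> {} \<Longrightarrow> \<exists>w\<in>W. card {y \<in> W. {w, y} \<in> E} \<le> 3"
  shows "\<exists>c :: 'a \<Rightarrow> nat. (\<forall>x. c x < 4) \<and>
    (\<forall>x\<in>V. \<forall>y\<in>V. x \<noteq> y \<longrightarrow> {x, y} \<in> E \<longrightarrow> c x \<noteq> c y)"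
  using assms
proof (induction V rule: finite_psubset_induct)
  case (psubset V)
  show ?case
  proof (cases "V = {}")
    case True
    then show ?thesis by (intro exI[of _ "\<lambda>_. 0"]) auto
  next
    case False
    then obtain w where w: "w \<in> V" "card {y \<in> V. {w, y} \<in> E} \<le> 3"
      using psubset.prems[of V] by auto
    have "V - {w} \<subset> V" using w by auto
    then have "\<exists>c :: 'a \<Rightarrow> nat. (\<forall>x. c x < 4) \<and>
        (\<forall>x\<in>V - {w}. \<forall>y\<in>V - {w}. x \<noteq> y \<longrightarrow> {x, y} \<in> E \<longrightarrow> c x \<noteq> c y)"
      by (rule psubset.IH) (rule psubset.prems, auto)
    then obtain c :: "'a \<Rightarrow> nat" where c: "\<forall>x. c x < 4"
      "\<forall>x\<in>V - {w}. \<forall>y\<in>V - {w}. x \<noteq> y \<longrightarrow> {x, y} \<in> E \<longrightarrow> c x \<noteq> c y"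
      by (elim exE conjE)
    let ?N = "{y \<in> V. {w, y} \<in> E}"
    have "card (c ` ?N) \<le> 3"
      using w(2) card_image_le[of ?N c] psubset.hyps by simp
    then have "\<not> {..<4} \<subseteq> c ` ?N"
      using card_mono[of "c ` ?N" "{..<4::nat}"] psubset.hyps by auto
    then obtain k where k: "k < 4" "k \<notin> c ` ?N" by auto
    have "(c(w := k)) x \<noteq> (c(w := k)) y"
      if "x \<in> V" "y \<in> V" "x \<noteq> y" "{x, y} \<in> E" for x y
    proof -
      have "{y, x} \<in> E" using that(4) by (simp add: insert_commute)
      then show ?thesis using that k(2) c(2) by (cases "x = w"; cases "y = w") (auto simp: image_iff)
    qed
    then show ?thesis using c(1) k(1) by (intro exI[of _ "c(w := k)"]) auto
  qed
qed

text \<open>Handshake count: if every vertex of \<open>W\<close> had at least \<open>2 * d\<close>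
  neighbours in \<open>W\<close>, summing degrees would give at least \<open>d * card W\<close>
  edges inside \<open>W\<close>.\<close>

lemma exists_low_degree:
  assumes fin: "finite W" and ne: "W \<noteq> {}"
    and edges: "\<And>e. e \<in> E \<Longrightarrow> card e = 2"
    and sparse: "card {e \<in> E. e \<subseteq> W} < d * card W"
  shows "\<exists>w\<in>W. card {y \<in> W. {w, y} \<in> E} < 2 * d"
proof (rule ccontr)
  assume "\<not> ?thesis"
  then have big: "2 * d \<le> card {y \<in> W. {w, y} \<in> E}" if "w \<in> W" for w
    using that by (meson not_le)
  let ?F = "{e \<in> E. e \<subseteq> W}"
  have finF: "finite ?F" using fin by (auto intro: finite_subset[of _ "Pow W"])
  have "2 * d * card W = (\<Sum>w\<in>W. 2 * d)" by simp
  also have "\<dots> \<le> (\<Sum>w\<in>W. card {e \<in> ?F. w \<in> e})"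
  proof (rule sum_mono)
    fix w assume w: "w \<in> W"
    have "inj_on (\<lambda>y. {w, y}) {y \<in> W. {w, y} \<in> E}"
      by (auto intro!: inj_onI simp: doubleton_eq_iff)
    moreover have "(\<lambda>y. {w, y}) ` {y \<in> W. {w, y} \<in> E} \<subseteq> {e \<in> ?F. w \<in> e}"
      using w by auto
    ultimately have "card {y \<in> W. {w, y} \<in> E} \<le> card {e \<in> ?F. w \<in> e}"
      using card_inj_on_le finite_subset[OF _ finF, of "{e \<in> ?F. w \<in> e}"] by blast
    then show "2 * d \<le> card {e \<in> ?F. w \<in> e}" using big[OF w] by linarith
  qed
  also have "\<dots> = 2 * card ?F"
  proof (rule sum_multicount[OF fin finF], intro ballI)
    fix e assume "e \<in> ?F"
    then have "{w \<in> W. w \<in> e} = e" "card e = 2" using edges by auto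
    then show "card {w \<in> W. w \<in> e} = 2" by simp
  qed
  finally show False using sparse by simp
qed

section \<open>Paths as vertex lists, and reachability\<close>

lemma path_edges_Nil [simp]: "path_edges [] = {}"
  and path_edges_single [simp]: "path_edges [x] = {}"
  by (auto simp: path_edges_def)

lemma path_edges_Cons_Cons [simp]:
  "path_edges (x # y # zs) = insert {x, y} (path_edges (y # zs))"
proof -
  have "(\<exists>i. f = {(x # y # zs) ! i, (x # y # zs) ! Suc i} \<and> Suc i < length (x # y # zs)) \<longleftrightarrow>
      f = {x, y} \<or> (\<exists>i. f = {(y # zs) ! i, (y # zs) ! Suc i} \<and> Suc i < length (y # zs))"
    (is "?l \<longleftrightarrow> ?r") for f
  proof
    assume ?l
    then obtain i where i: "f = {(x # y # zs) ! i, (x # y # zs) ! Suc i}" "Suc i < length (x # y # zs)"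
      by blast
    then show ?r by (cases i) auto
  next
    assume ?r
    then show ?l
    proof
      assume "\<exists>i. f = {(y # zs) ! i, (y # zs) ! Suc i} \<and> Suc i < length (y # zs)"
      then obtain i where "f = {(y # zs) ! i, (y # zs) ! Suc i}" "Suc i < length (y # zs)" by blast
      then show ?l by (intro exI[of _ "Suc i"]) auto
    qed (auto intro: exI[of _ 0])
  qed
  then show ?thesis
    by (intro Set.set_eqI) (simp only: path_edges_def mem_Collect_eq insert_iff)
qed

lemma path_edges_append:
  "xs \<noteq> [] \<Longrightarrow> ys \<noteq> [] \<Longrightarrow>
    path_edges (xs @ ys) = path_edges xs \<union> insert {last xs, hd ys} (path_edges ys)"
proof (induction xs)
  case (Cons x xs)
  then show ?case by (cases xs; cases ys) auto
qed simp

lemma path_edges_rev: "path_edges (rev xs) = path_edges xs"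
proof (induction xs)
  case (Cons x xs)
  then show ?case
    using path_edges_append[of "rev xs" "[x]"]
    by (cases xs) (simp_all add: last_rev insert_commute)
qed simp

lemma Union_path_edges_subset: "\<Union> (path_edges xs) \<subseteq> set xs"
  by (auto simp: path_edges_def)

lemma vpath_iff: "vpath F xs \<longleftrightarrow> xs \<noteq> [] \<and> distinct xs \<and> path_edges xs \<subseteq> F"
  by (auto simp: vpath_def path_edges_def)

lemma vpath_appendD:
  assumes "vpath F (xs @ ys)"
  shows "xs \<noteq> [] \<Longrightarrow> vpath F xs" and "ys \<noteq> [] \<Longrightarrow> vpath F ys"
  using assms by (cases "xs = []"; cases "ys = []"; auto simp: vpath_iff path_edges_append)+

lemma vpath_rev: "vpath F xs \<Longrightarrow> vpath F (rev xs)"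
  by (simp add: vpath_iff path_edges_rev)

text \<open>The closure of this relation expresses reachability in a form suited to induction and
  symmetry; the lemmas below translate to and from vertex lists.\<close>

definition edge_rel :: "'a set set \<Rightarrow> ('a \<times> 'a) set" where
  "edge_rel F = {(a, b). {a, b} \<in> F}"

lemma sym_rtrancl_edge_rel: "sym ((edge_rel F)\<^sup>*)"
  by (rule sym_rtrancl) (auto simp: edge_rel_def sym_def insert_commute)

lemma path_edges_rtrancl:
  "path_edges xs \<subseteq> F \<Longrightarrow> x \<in> set xs \<Longrightarrow> (hd xs, x) \<in> (edge_rel F)\<^sup>*"
proof (induction xs)
  case (Cons a xs)
  show ?case
  proof (cases "x = a")
    case False
    then obtain b ys where xs: "xs = b # ys" using Cons.prems by (cases xs) auto
    then have "(a, b) \<in> edge_rel F" "(b, x) \<in> (edge_rel F)\<^sup>*"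
      using Cons False by (auto simp: edge_rel_def)
    then show ?thesis by (simp add: converse_rtrancl_into_rtrancl)
  qed simp
qed simp

lemma rtrancl_edge_rel_vpath:
  assumes "(x, y) \<in> (edge_rel F)\<^sup>*"
  shows "\<exists>xs. vpath F xs \<and> hd xs = x \<and> last xs = y"
  using assms
proof (induction rule: rtrancl_induct)
  case base
  show ?case by (intro exI[of _ "[x]"]) (simp add: vpath_iff)
next
  case (step y z)
  then obtain xs where xs: "vpath F xs" "hd xs = x" "last xs = y" by blast
  show ?case
  proof (cases "z \<in> set xs")
    case True
    \<comment> \<open>If \<open>z\<close> is already on the path, cutting the path at
      \<open>z\<close> keeps its vertices distinct.\<close>
    then obtain as bs where asbs: "xs = as @ z # bs" by (auto dest: split_list)
    then have "vpath F (as @ [z])" using xs(1) vpath_appendD(1)[of F "as @ [z]" bs] by simp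
    then show ?thesis using xs(2) asbs
      by (intro exI[of _ "as @ [z]"]) (cases as; simp)
  next
    case False
    have "vpath F (xs @ [z])"
      using xs False step(2) by (auto simp: vpath_iff path_edges_append edge_rel_def)
    then show ?thesis using xs(1,2) by (intro exI[of _ "xs @ [z]"]) (auto simp: vpath_iff)
  qed
qed

lemma vpath_set_subset:
  assumes "vpath F xs" "hd xs \<in> \<Union> F"
  shows "set xs \<subseteq> \<Union> F"
proof
  fix x assume "x \<in> set xs"
  then have "x = hd xs \<or> x \<in> \<Union> (path_edges xs)"
  proof (induction xs)
    case (Cons a xs)
    then show ?case by (cases xs) auto
  qed simp
  then show "x \<in> \<Union> F" using assms by (auto simp: vpath_iff)
qed

section \<open>Normal spanning trees\<close>

locale normal_tree =
  fixes n :: nat and E T :: "nat set set" and r :: nat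
  assumes simple: "simple_graph n E" and normal: "normal_spanning_tree n E T r"
begin

lemma T_subset: "T \<subseteq> E" and r_less: "r < n" and T_connected: "connected_on {0..<n} T"
  and T_acyclic: "acyclic_edges T"
  using normal by (auto simp: normal_spanning_tree_def spanning_tree_def)

lemma edge_less: "{x, y} \<in> E \<Longrightarrow> x < n \<and> y < n \<and> x \<noteq> y"
  using simple unfolding simple_graph_def by (fastforce simp: doubleton_eq_iff)

lemma edgeE:
  assumes "e \<in> E"
  obtains u v where "e = {u, v}" "u < n" "v < n" "u \<noteq> v"
  using assms simple unfolding simple_graph_def by blast

lemma card_edge: "e \<in> E \<Longrightarrow> card e = 2"
  by (erule edgeE) auto

lemma finite_E: "finite E"
proof (rule finite_subset)
  show "E \<subseteq> Pow {..<n}" by (auto elim!: edgeE)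
qed simp

text \<open>Acyclicity is stated as uniqueness of paths, which is what the definite description in
  \<open>tpath\<close> requires.\<close>

lemma tpath_eq: "vpath T xs \<Longrightarrow> tpath T (hd xs) (last xs) = xs"
  unfolding tpath_def using T_acyclic unfolding acyclic_edges_def by (intro the_equality) blast+

abbreviation root_path :: "nat \<Rightarrow> nat list" where "root_path \<equiv> tpath T r"
abbreviation le :: "nat \<Rightarrow> nat \<Rightarrow> bool" (infix \<open>\<preceq>\<close> 50) where "le \<equiv> tree_le T r"
abbreviation lt :: "nat \<Rightarrow> nat \<Rightarrow> bool" (infix \<open>\<prec>\<close> 50) where "x \<prec> y \<equiv> x \<preceq> y \<and> x \<noteq> y"
abbreviation depth :: "nat \<Rightarrow> nat" where "depth x \<equiv> length (root_path x)"

lemma root_path: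
  assumes "y < n"
  shows "vpath T (root_path y)" "hd (root_path y) = r" "last (root_path y) = y"
    "set (root_path y) \<subseteq> {0..<n}" "root_path y \<noteq> []"
proof -
  obtain xs where xs: "vpath T xs" "hd xs = r" "last xs = y" "set xs \<subseteq> {0..<n}"
    using T_connected assms r_less unfolding connected_on_def by fastforce
  then have eq: "root_path y = xs" using tpath_eq[OF xs(1)] by simp
  show "vpath T (root_path y)" "hd (root_path y) = r" "last (root_path y) = y"
    "set (root_path y) \<subseteq> {0..<n}" "root_path y \<noteq> []"
    using xs by (auto simp: eq vpath_def)
qed

lemma root_path_prefix:
  assumes "y < n" "root_path y = xs @ zs" "xs \<noteq> []"
  shows "root_path (last xs) = xs"
proof -
  have "vpath T xs" "hd xs = r"
    using root_path[OF assms(1)] vpath_appendD(1)[of T xs zs] assms by auto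
  then show ?thesis using tpath_eq[of xs] by simp
qed

text \<open>The tree order is the prefix order on root paths: by uniqueness, the part up to
  \<open>x\<close> is the root path of \<open>x\<close>, and the part from \<open>x\<close> on is
  the tree path to \<open>y\<close>.\<close>

lemma leE:
  assumes "y < n" "x \<preceq> y"
  obtains zs where "root_path y = root_path x @ zs" "tpath T x y = x # zs" "x < n"
proof -
  obtain as zs where eq: "root_path y = as @ x # zs"
    using assms(2) unfolding tree_le_def by (auto dest: split_list)
  then have "root_path x = as @ [x]"
    using root_path_prefix[OF assms(1), of "as @ [x]" zs] by simp
  moreover have "tpath T x y = x # zs"
    using root_path[OF assms(1)] vpath_appendD(2)[of T as "x # zs"] tpath_eq[of "x # zs"] eq by auto
  ultimately show ?thesis
    using eq root_path(4)[OF assms(1)] that[of zs] by auto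
qed

lemma le_less: "y < n \<Longrightarrow> x \<preceq> y \<Longrightarrow> x < n"
  by (erule leE)

lemma le_refl: "y < n \<Longrightarrow> y \<preceq> y"
  using root_path unfolding tree_le_def by (metis last_in_set)

lemma le_antisym:
  assumes "y < n" "x \<preceq> y" "y \<preceq> x"
  shows "x = y"
proof -
  obtain zs where zs: "root_path y = root_path x @ zs" "x < n" by (rule leE[OF assms(1,2)])
  obtain ws where ws: "root_path x = root_path y @ ws" by (rule leE[OF zs(2) assms(3)])
  have "length zs + length ws = 0"
    using zs(1) ws arg_cong[OF zs(1), of length] arg_cong[OF ws, of length] by simp
  then show ?thesis
    using zs ws root_path(3)[OF assms(1)] root_path(3)[OF zs(2)] by simp
qed

lemma le_trans:
  assumes "z < n" "x \<preceq> y" "y \<preceq> z"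
  shows "x \<preceq> z"
proof -
  obtain zs where "root_path z = root_path y @ zs" by (rule leE[OF assms(1,3)])
  then show ?thesis using assms(2) unfolding tree_le_def by simp
qed

text \<open>Two prefixes of the same root path are comparable as lists.\<close>

lemma le_chain:
  assumes "z < n" "x \<preceq> z" "y \<preceq> z"
  shows "x \<preceq> y \<or> y \<preceq> x"
proof -
  obtain as where as: "root_path z = root_path x @ as" "x < n" by (rule leE[OF assms(1,2)])
  obtain bs where bs: "root_path z = root_path y @ bs" "y < n" by (rule leE[OF assms(1,3)])
  have "root_path x @ as = root_path y @ bs" using as bs by simp
  then consider ds where "root_path x = root_path y @ ds" | ds where "root_path y = root_path x @ ds"
    unfolding append_eq_append_conv2 by metis
  then show ?thesis
    unfolding tree_le_def using root_path(3,5)[OF as(2)] root_path(3,5)[OF bs(2)]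
    by cases (metis UnI1 last_in_set set_append)+
qed

lemma depth_less:
  assumes "y < n" "x \<prec> y"
  shows "depth x < depth y"
proof -
  obtain zs where "root_path y = root_path x @ zs" "x < n" by (rule leE[OF assms(1)]) (use assms in auto)
  then show ?thesis
    using root_path(3)[OF assms(1)] root_path(3)[of x] assms(2) by (cases "zs = []") auto
qed

text \<open>Normality enters here: every edge has an upper end \<open>u\<close> and a lower end
  \<open>v\<close>.\<close>

lemma edge_orientE:
  assumes "e \<in> E"
  obtains u v where "e = {u, v}" "u < n" "v < n" "u \<prec> v"
proof -
  obtain x y where xy: "e = {x, y}" "x < n" "y < n" "x \<noteq> y" using edgeE[OF assms] .
  have "x \<preceq> y \<or> y \<preceq> x"
    using assms normal xy(1) unfolding normal_spanning_tree_def by blast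
  then show ?thesis using that xy by (metis insert_commute)
qed

text \<open>Indexes tree edges by their lower endpoint. The value at the root is meaningless, but
  spans contain only vertices with a strict ancestor.\<close>

definition parent_edge :: "nat \<Rightarrow> nat set" where
  "parent_edge z = {last (butlast (root_path z)), z}"

text \<open>Descending from \<open>u\<close> to \<open>v\<close>, each vertex after \<open>u\<close>
  contributes the edge to its predecessor. The induction appends vertices at the lower end, where
  the new edge is the parent edge of the new vertex.\<close>

lemma path_edges_tpath:
  assumes v: "v < n" and uv: "u \<preceq> v"
  shows "path_edges (tpath T u v) = parent_edge ` {z. u \<prec> z \<and> z \<preceq> v}"
proof -
  obtain zs where zs: "root_path v = root_path u @ zs" "tpath T u v = u # zs" "u < n"
    by (rule leE[OF v uv])
  note u = root_path[OF zs(3)]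
  have "path_edges (u # zs) = parent_edge ` set zs"
    using v zs(1)
  proof (induction zs arbitrary: v rule: rev_induct)
    case (snoc w ws)
    let ?p = "last (root_path u @ ws)"
    have w: "w = v" using root_path(3)[OF snoc.prems(1)] snoc.prems(2) by simp
    have p: "root_path ?p = root_path u @ ws"
      using root_path_prefix[OF snoc.prems(1), of "root_path u @ ws" "[w]"] snoc.prems(2) u(5) by simp
    have "?p \<in> set (root_path v)"
      using snoc.prems(2) u(5) last_in_set[of "root_path u @ ws"] by simp
    then have "?p < n" using root_path(4)[OF snoc.prems(1)] by auto
    then have "path_edges (u # ws) = parent_edge ` set ws" using snoc.IH p by blast
    moreover have "parent_edge w = {last (u # ws), w}"
      using snoc.prems(2) u(3) w by (simp add: parent_edge_def butlast_append)
    ultimately show ?case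
      using path_edges_append[of "u # ws" "[w]"] by auto
  qed simp
  moreover have "set zs = {z. u \<prec> z \<and> z \<preceq> v}"
  proof (rule Set.set_eqI, rule iffI)
    fix z assume z: "z \<in> set zs"
    then obtain as bs where "zs = as @ z # bs" by (auto dest: split_list)
    then have "root_path z = root_path u @ as @ [z]"
      using root_path_prefix[OF v, of "root_path u @ as @ [z]" bs] zs(1) by simp
    then have "u \<preceq> z" using u(3,5) unfolding tree_le_def by (metis UnI1 last_in_set set_append)
    moreover have "z \<preceq> v" using z zs(1) by (simp add: tree_le_def)
    moreover have "distinct (root_path u @ zs)" using root_path(1)[OF v] zs(1) by (simp add: vpath_def)
    then have "u \<noteq> z" using z u(3,5) last_in_set by fastforce
    ultimately show "z \<in> {z. u \<prec> z \<and> z \<preceq> v}" by simp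
  next
    fix z assume "z \<in> {z. u \<prec> z \<and> z \<preceq> v}"
    then have z: "u \<prec> z" "z \<preceq> v" by auto
    have "\<not> z \<preceq> u" using le_antisym[OF zs(3)] z by blast
    then show "z \<in> set zs" using z(2) zs(1) unfolding tree_le_def by simp
  qed
  ultimately show ?thesis using zs(2) by simp
qed

section \<open>Counting edges inside a vertex set\<close>

text \<open>The lower endpoints of the tree edges on the fundamental cycle of \<open>e\<close>.\<close>

definition tree_span :: "nat set \<Rightarrow> nat set" where
  "tree_span e = {z. \<exists>u v. e = {u, v} \<and> u \<prec> z \<and> z \<preceq> v}"

text \<open>\<open>tree_span\<close> sees an unordered edge and so allows both readings of its ends;
  antisymmetry makes the reversed reading contribute nothing.\<close>

lemma tree_span_eq:
  assumes "v < n" "u \<prec> v"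
  shows "tree_span {u, v} = {z. u \<prec> z \<and> z \<preceq> v}"
proof -
  have False if "v \<prec> z" "z \<preceq> u" for z
  proof -
    have u: "u < n" using le_less assms by blast
    have "v \<preceq> u" using le_trans[OF u] that by blast
    then show False using le_antisym[OF u] assms(2) by blast
  qed
  then show ?thesis unfolding tree_span_def by (auto simp: doubleton_eq_iff)
qed

abbreviation NT :: "nat set set" where "NT \<equiv> nontree_edges E T"

lemma NT_E: "e \<in> NT \<Longrightarrow> e \<in> E"
  by (simp add: nontree_edges_def)

lemma finite_NT: "finite NT"
  using finite_E by (simp add: nontree_edges_def)

lemma tpath:
  assumes v: "v < n" and uv: "u \<preceq> v"
  shows "vpath T (tpath T u v)" "hd (tpath T u v) = u" "last (tpath T u v) = v"
proof -
  obtain zs where zs: "root_path v = root_path u @ zs" "tpath T u v = u # zs" "u < n"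
    by (rule leE[OF v uv])
  have "root_path v = butlast (root_path u) @ (u # zs)"
    using zs(1) append_butlast_last_id[OF root_path(5)[OF zs(3)]] root_path(3)[OF zs(3)]
    by (metis append.assoc append_Cons append_Nil)
  then show "vpath T (tpath T u v)" "hd (tpath T u v) = u" "last (tpath T u v) = v"
    using root_path(1,3)[OF v] vpath_appendD(2)[of T "butlast (root_path u)" "u # zs"] zs(2)
    by auto
qed

lemma tpath_rev:
  assumes v: "v < n" and uv: "u \<preceq> v"
  shows "tpath T v u = rev (tpath T u v)"
  using tpath_eq[OF vpath_rev[OF tpath(1)[OF assms]]] tpath[OF assms]
  by (simp add: hd_rev last_rev)

text \<open>\<open>fcyc\<close> also unites over both orientations of \<open>e\<close>; the two tree
  paths are reverses of each other and have the same edges.\<close>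

lemma fcyc_eq:
  assumes "e \<in> E"
  shows "fcyc T e = insert e (parent_edge ` tree_span e)"
proof -
  obtain u v where uv: "e = {u, v}" "v < n" "u \<prec> v" using edge_orientE[OF assms] by metis
  have "\<Union> {path_edges (tpath T x y) | x y. e = {x, y}}
      = path_edges (tpath T u v) \<union> path_edges (tpath T v u)"
    unfolding uv(1) by (auto simp: doubleton_eq_iff)
  also have "\<dots> = parent_edge ` tree_span e"
    using uv tree_span_eq[OF uv(2,3)] path_edges_tpath[OF uv(2)] by (simp add: tpath_rev path_edges_rev)
  finally show ?thesis unfolding fcyc_def by simp
qed

lemma parent_edges_span:
  assumes "e = {u, v}" "v < n" "u \<prec> v"
  shows "parent_edge ` tree_span e = path_edges (tpath T u v)"
  using assms path_edges_tpath[of v u] tree_span_eq by simp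

lemma parent_edge_span_T: "e \<in> E \<Longrightarrow> parent_edge ` tree_span e \<subseteq> T"
  by (metis edge_orientE parent_edges_span tpath(1) vpath_iff)

lemma fsum_Int_T:
  assumes "S \<subseteq> NT"
  shows "fsum T S \<inter> T = (\<Union>e\<in>S. parent_edge ` tree_span e)"
proof -
  have "fcyc T e \<inter> T = parent_edge ` tree_span e" if "e \<in> S" for e
  proof -
    have "e \<in> E" "e \<notin> T" using that assms by (auto simp: nontree_edges_def)
    then show ?thesis by (simp add: fcyc_eq parent_edge_span_T Int_insert_left Int_absorb2)
  qed
  moreover have "fsum T S \<inter> T = (\<Union>e\<in>S. fcyc T e \<inter> T)" unfolding fsum_def by blast
  ultimately show ?thesis by simp
qed

text \<open>A fundamental cycle has only one non-tree edge. If its span were already covered, that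
  edge alone could be new, whereas the threshold asks for at least two new edges.\<close>

lemma fresh_tree_span:
  assumes "e \<in> NT" "A \<subseteq> NT" "card (fcyc T e - fsum T A) > 1"
  shows "\<not> tree_span e \<subseteq> \<Union> (tree_span ` A)"
proof
  assume sub: "tree_span e \<subseteq> \<Union> (tree_span ` A)"
  have "parent_edge ` tree_span e \<subseteq> fsum T A"
  proof
    fix f assume "f \<in> parent_edge ` tree_span e"
    then obtain z a where "f = parent_edge z" "a \<in> A" "z \<in> tree_span a" using sub by blast
    then show "f \<in> fsum T A"
      using fcyc_eq[of a] NT_E[of a] assms(2) unfolding fsum_def by blast
  qed
  then have "fcyc T e - fsum T A \<subseteq> {e}"
    using fcyc_eq[OF NT_E[OF assms(1)]] by blast
  then have "card (fcyc T e - fsum T A) \<le> card {e}" by (intro card_mono) auto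
  then show False using assms(3) by simp
qed

text \<open>Inside \<open>W\<close> a tree_span is determined by its trace on \<open>W\<close>: below every vertex of the tree_span
  there is a first element of \<open>W\<close>, and any edge inside \<open>W\<close> spanning that element
  also spans the segment above it.\<close>

lemma tree_span_trace_mono:
  assumes e: "e \<in> E" "e \<subseteq> W" and A: "\<And>a. a \<in> A \<Longrightarrow> a \<in> E \<and> a \<subseteq> W"
    and trace: "tree_span e \<inter> W \<subseteq> (\<Union>a\<in>A. tree_span a)"
  shows "tree_span e \<subseteq> \<Union> (tree_span ` A)"
proof
  fix z assume z: "z \<in> tree_span e"
  obtain u v where uv: "e = {u, v}" "u < n" "v < n" "u \<prec> v" using edge_orientE[OF e(1)] by metis
  have zuv: "u \<prec> z" "z \<preceq> v" using z tree_span_eq[OF uv(3,4)] uv(1) by auto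
  have "z < n" using le_less[OF uv(3) zuv(2)] .
  \<comment> \<open>The witness is the first vertex of \<open>W\<close> met on the way from
    \<open>z\<close> down to \<open>v\<close>; \<open>v\<close> itself is a candidate.\<close>
  let ?M = "\<lambda>w. w \<in> W \<and> z \<preceq> w \<and> w \<preceq> v"
  have "?M v" using uv e(2) zuv le_refl by auto
  then obtain w where w: "?M w" and min: "\<And>w'. ?M w' \<Longrightarrow> depth w \<le> depth w'"
    using ex_has_least_nat[of ?M v depth] by blast
  have wn: "w < n" using le_less[OF uv(3)] w by blast
  have "u \<prec> w" using le_trans[OF wn] zuv(1) w le_antisym[OF \<open>z < n\<close>] by blast
  then have "w \<in> tree_span e \<inter> W" using w tree_span_eq[OF uv(3,4)] uv(1) by auto
  then obtain a where a: "a \<in> A" "w \<in> tree_span a" using trace by blast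
  then obtain u' v' where uv': "a = {u', v'}" "u' < n" "v' < n" "u' \<prec> v'"
    using edge_orientE[of a] A by metis
  have wuv': "u' \<prec> w" "w \<preceq> v'" using a(2) tree_span_eq[OF uv'(3,4)] uv'(1) by auto
  \<comment> \<open>Otherwise \<open>u'\<close>, an element of \<open>W\<close> strictly above
    \<open>w\<close>, would be a shallower candidate.\<close>
  have "\<not> z \<preceq> u'"
  proof
    assume "z \<preceq> u'"
    moreover have "u' \<in> W" using uv'(1) A[OF a(1)] by blast
    moreover have "u' \<preceq> v" using le_trans[OF uv(3)] wuv' w by blast
    ultimately have "depth w \<le> depth u'" using min by blast
    then show False using depth_less[OF wn wuv'(1)] by simp
  qed
  moreover have "u' \<preceq> z \<or> z \<preceq> u'" using le_chain[OF wn] wuv' w by blast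
  ultimately have "u' \<prec> z" using le_refl \<open>z < n\<close> by blast
  moreover have "z \<preceq> v'" using le_trans[OF uv'(3)] w wuv' by blast
  ultimately have "z \<in> tree_span a" using tree_span_eq[OF uv'(3,4)] uv'(1) by auto
  then show "z \<in> \<Union> (tree_span ` A)" using a(1) by blast
qed

text \<open>Equal traces give equal spans by monotonicity in both directions. The span determines
  \<open>v\<close> as its lowest vertex; the upper ends are comparable, and if they differed, the
  lower of the two would lie in one span only.\<close>

lemma tree_span_trace_inj:
  assumes e: "e \<in> E" "e \<subseteq> W" and f: "f \<in> E" "f \<subseteq> W" and eq: "tree_span e \<inter> W = tree_span f \<inter> W"
  shows "e = f"
proof -
  have tree_span: "tree_span e = tree_span f"
    using tree_span_trace_mono[OF e, of "{f}"] tree_span_trace_mono[OF f, of "{e}"] e f eq by auto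
  obtain u v where uv: "e = {u, v}" "u < n" "v < n" "u \<prec> v" using edge_orientE[OF e(1)] by metis
  obtain u' v' where uv': "f = {u', v'}" "u' < n" "v' < n" "u' \<prec> v'" using edge_orientE[OF f(1)] by metis
  have eq: "z \<in> {z. u \<prec> z \<and> z \<preceq> v} \<longleftrightarrow> z \<in> {z. u' \<prec> z \<and> z \<preceq> v'}" for z
    using tree_span tree_span_eq[OF uv(3,4)] tree_span_eq[OF uv'(3,4)] uv(1) uv'(1) by simp
  have "v \<preceq> v'" "v' \<preceq> v"
    using eq[of v] eq[of v'] uv(4) uv'(4) le_refl[OF uv(3)] le_refl[OF uv'(3)] by simp_all
  then have v: "v = v'" using le_antisym[OF uv'(3)] by simp
  have "u = u'"
    using le_chain[OF uv(3), of u u'] eq[of u] eq[of u'] uv(4) uv'(4) v by auto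
  then show ?thesis using v uv(1) uv'(1) by simp
qed

lemma tree_span_trace_nonempty:
  assumes "e \<in> E" "e \<subseteq> W"
  shows "tree_span e \<inter> W \<noteq> {}"
proof -
  obtain u v where uv: "e = {u, v}" "u < n" "v < n" "u \<prec> v" using edge_orientE[OF assms(1)] by metis
  then have "v \<in> tree_span e \<inter> W" using tree_span_eq[OF uv(3,4)] assms(2) le_refl by auto
  then show ?thesis by blast
qed

section \<open>Non-tree edges against recorded vertices under DEP\<close>

definition inside :: "nat set \<Rightarrow> nat set set \<Rightarrow> nat set set" where
  "inside W S = {e \<in> S. e \<subseteq> W}"

text \<open>These are the recorded vertices. The counting aims at at most one more edge in
  \<open>inside W S\<close> than vertices here.\<close>

definition spanned :: "nat set \<Rightarrow> nat set set \<Rightarrow> nat set" where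
  "spanned W S = (\<Union>e\<in>inside W S. tree_span e \<inter> W)"

text \<open>Covers the cycles an ordering starts from, for which DEP promises nothing fresh: two
  distinct edges already record two vertices, and there are at most three edges.\<close>

lemma card_inside_small:
  assumes fin: "finite W" and A: "A \<subseteq> E" "card A \<le> 3"
  shows "card (inside W A) \<le> card (spanned W A) + 1"
proof (cases "card (inside W A) \<le> 1")
  case False
  have finA: "finite A" using A(1) finite_E finite_subset by blast
  then have finB: "finite (inside W A)" by (simp add: inside_def)
  obtain a b where ab: "a \<in> inside W A" "b \<in> inside W A" "a \<noteq> b"
    using False card_le_Suc0_iff_eq[OF finB] by auto
  let ?N = "\<lambda>e. tree_span e \<inter> W"
  have "?N a \<noteq> ?N b" "?N a \<noteq> {}" "?N b \<noteq> {}"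
    using tree_span_trace_inj[of a W b] tree_span_trace_nonempty[of a W] tree_span_trace_nonempty[of b W] ab A(1)
    unfolding inside_def by auto
  \<comment> \<open>Two different nonempty sets cannot both lie in one singleton.\<close>
  then obtain x y where "x \<in> ?N a \<union> ?N b" "y \<in> ?N a \<union> ?N b" "x \<noteq> y" by blast
  then have xy: "{x, y} \<subseteq> spanned W A" "card {x, y} = 2" using ab unfolding spanned_def by auto
  have "finite (spanned W A)"
    by (rule finite_subset[OF _ fin]) (auto simp: spanned_def)
  then have "2 \<le> card (spanned W A)" using card_mono[OF _ xy(1)] xy(2) by simp
  moreover have "card (inside W A) \<le> 3"
    using card_mono[OF finA, of "inside W A"] A(2) by (simp add: inside_def)
  ultimately show ?thesis by simp
qed simp

text \<open>Along the ordering, an edge leaving \<open>W\<close> changes neither side, while an edge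
  inside \<open>W\<close> adds one to the left and at least one recorded vertex to the
  right.\<close>

lemma card_inside_ordering:
  assumes fin: "finite W" and A: "A \<subseteq> NT" "card A \<le> 3"
    and ks: "set ks \<subseteq> NT"
    and new: "\<And>i. i < length ks \<Longrightarrow> card (fcyc T (ks ! i) - fsum T (A \<union> set (take i ks))) > 1"
  shows "card (inside W (A \<union> set ks)) \<le> card (spanned W (A \<union> set ks)) + 1"
  using ks new
proof (induction ks rule: rev_induct)
  case Nil
  then show ?case using card_inside_small[OF fin _ A(2)] A(1) NT_E by auto
next
  case (snoc k ks)
  let ?S = "A \<union> set ks"
  have S: "?S \<subseteq> NT" and k: "k \<in> NT" using snoc.prems(1) A(1) by auto
  have new: "card (fcyc T (ks ! i) - fsum T (A \<union> set (take i ks))) > 1" if "i < length ks" for i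
    using snoc.prems(2)[of i] that by (simp add: nth_append)
  have IH: "card (inside W ?S) \<le> card (spanned W ?S) + 1"
    by (rule snoc.IH) (use snoc.prems(1) new in auto)
  have finS: "finite (inside W ?S)"
    by (rule finite_subset[OF _ finite_NT]) (use S in \<open>auto simp: inside_def\<close>)
  have fint: "finite (spanned W B)" for B
    by (rule finite_subset[OF _ fin]) (auto simp: spanned_def)
  show ?case
  proof (cases "k \<subseteq> W")
    case False
    then have "inside W (A \<union> set (ks @ [k])) = inside W ?S" by (auto simp: inside_def)
    then show ?thesis using IH by (simp add: spanned_def)
  next
    case True
    have inside: "inside W (A \<union> set (ks @ [k])) = insert k (inside W ?S)"
      using True by (auto simp: inside_def)
    have "\<not> tree_span k \<subseteq> \<Union> (tree_span ` ?S)"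
      using snoc.prems(2)[of "length ks"] fresh_tree_span[OF k S] by simp
    \<comment> \<open>Freshness against all predecessors gives freshness against those inside
      \<open>W\<close>, and only for these does the trace on \<open>W\<close> detect it.\<close>
    then have "\<not> tree_span k \<subseteq> \<Union> (tree_span ` inside W ?S)" by (auto simp: inside_def)
    then have "\<not> tree_span k \<inter> W \<subseteq> (\<Union>a\<in>inside W ?S. tree_span a)"
      using tree_span_trace_mono[OF NT_E[OF k] True, of "inside W ?S"] S NT_E
      unfolding inside_def by blast
    then have "spanned W ?S \<subset> spanned W (A \<union> set (ks @ [k]))"
      unfolding spanned_def inside by auto
    then have "card (spanned W ?S) < card (spanned W (A \<union> set (ks @ [k])))"
      by (intro psubset_card_mono fint)
    moreover have "card (inside W (A \<union> set (ks @ [k]))) \<le> Suc (card (inside W ?S))"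
      unfolding inside using finS by (simp add: card_insert_if)
    ultimately show ?thesis using IH by linarith
  qed
qed

text \<open>The starting cycles are the three that form the \<open>K4\<close> subdivision, or else
  the first cycle of the ordering, on which DEP imposes no condition.\<close>

lemma card_inside_DEP:
  assumes fin: "finite W" and S: "S \<subseteq> NT" and dep: "DEP T S"
  shows "card (inside W S) \<le> card (spanned W S) + 1"
proof (cases "K4_initiated T S")
  case True
  then obtain e1 e2 e3 ks where K: "K4_initiated_by T S e1 e2 e3" and ks: "set ks = S - {e1, e2, e3}"
    and new: "\<And>i. i < length ks \<Longrightarrow> card (fcyc T (ks ! i) -
        (fcyc T e1 \<union> fcyc T e2 \<union> fcyc T e3 \<union> fsum T (set (take i ks)))) > 1"
    using dep unfolding DEP_def by auto
  let ?A = "{e1, e2, e3}"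
  have A: "?A \<subseteq> S" using K unfolding K4_initiated_by_def by auto
  then have eq: "?A \<union> set ks = S" using ks by auto
  have "card (inside W (?A \<union> set ks)) \<le> card (spanned W (?A \<union> set ks)) + 1"
  proof (rule card_inside_ordering[OF fin])
    show "?A \<subseteq> NT" using A S by (rule subset_trans)
    show "set ks \<subseteq> NT" using S unfolding ks by (rule subset_trans[OF Diff_subset])
    show "card ?A \<le> 3" by (simp add: card_insert_if)
    fix i assume "i < length ks"
    from new[OF this] show "card (fcyc T (ks ! i) - fsum T (?A \<union> set (take i ks))) > 1"
      by (simp add: fsum_def Un_assoc)
  qed
  then show ?thesis unfolding eq .
next
  case False
  then obtain ks where ks: "set ks = S"
    and new: "\<And>i. i < length ks \<Longrightarrow> 0 < i \<Longrightarrow> card (fcyc T (ks ! i) - fsum T (set (take i ks))) > 1"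
    using dep unfolding DEP_def by auto
  show ?thesis
  proof (cases ks)
    case Nil
    then show ?thesis using ks by (simp add: inside_def)
  next
    case (Cons k ks')
    have "card (inside W ({k} \<union> set ks')) \<le> card (spanned W ({k} \<union> set ks')) + 1"
    proof (rule card_inside_ordering[OF fin])
      show "{k} \<subseteq> NT" "set ks' \<subseteq> NT" using ks S Cons by auto
      show "card {k} \<le> 3" by simp
      fix i assume "i < length ks'"
      \<comment> \<open>Position \<open>i\<close> after the first cycle is position
        \<open>Suc i\<close> in \<open>ks\<close>, so the condition \<open>0 < i\<close> of DEP is
        met.\<close>
      then show "card (fcyc T (ks' ! i) - fsum T ({k} \<union> set (take i ks'))) > 1"
        using new[of "Suc i"] Cons by simp
    qed
    then show ?thesis using ks Cons by simp
  qed
qed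

section \<open>Components of the covered tree edges as maximal collections\<close>

definition covered :: "nat set set" where
  "covered = (\<Union>e\<in>NT. parent_edge ` tree_span e)"

text \<open>The non-tree edges within one such vertex set form a maximal collection as soon as there
  are any, so DEP can be applied to disjoint pieces of the vertex set.\<close>

definition component :: "nat \<Rightarrow> nat set" where
  "component x = (edge_rel covered)\<^sup>* `` {x}"

lemma in_component: "x \<in> component x"
  by (simp add: component_def)

lemma component_trans: "y \<in> component x \<Longrightarrow> (y, z) \<in> (edge_rel covered)\<^sup>* \<Longrightarrow> z \<in> component x"
  unfolding component_def by (auto intro: rtrancl_trans)

lemma component_connected:
  "y \<in> component x \<Longrightarrow> z \<in> component x \<Longrightarrow> (y, z) \<in> (edge_rel covered)\<^sup>*"
  unfolding component_def
  by (metis Image_singleton_iff rtrancl_trans symD[OF sym_rtrancl_edge_rel])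

lemma component_eqI:
  assumes "z \<in> component x" "z \<in> component y"
  shows "component x = component y"
  using assms unfolding component_def
  by (metis Image_singleton_iff rtrancl_trans set_eq_subset subsetI symD[OF sym_rtrancl_edge_rel])

text \<open>The tree path of \<open>e\<close> consists of covered edges and joins both ends of
  \<open>e\<close>, so a fundamental cycle that meets a component stays in it.\<close>

lemma fund_cycle_component:
  assumes e: "e \<in> NT" and a: "a \<in> e \<or> a \<in> \<Union> (parent_edge ` tree_span e)" and x: "a \<in> component x"
  shows "e \<union> \<Union> (parent_edge ` tree_span e) \<subseteq> component x"
proof -
  obtain u v where uv: "e = {u, v}" "v < n" "u \<prec> v" using edge_orientE[OF NT_E[OF e]] by metis
  let ?p = "tpath T u v"
  note p = tpath[OF uv(2), of u]
  have edges: "path_edges ?p = parent_edge ` tree_span e"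
    using parent_edges_span uv by simp
  then have cov: "path_edges ?p \<subseteq> covered" using e by (auto simp: covered_def)
  have "u \<in> set ?p" "v \<in> set ?p"
    using p uv(3) hd_in_set[of ?p] last_in_set[of ?p] by (auto simp: vpath_def)
  then have sub: "e \<union> \<Union> (parent_edge ` tree_span e) \<subseteq> set ?p"
    using Union_path_edges_subset[of ?p] uv(1) unfolding edges by simp
  have reach: "(u, b) \<in> (edge_rel covered)\<^sup>*" if "b \<in> e \<union> \<Union> (parent_edge ` tree_span e)" for b
    using path_edges_rtrancl[OF cov subsetD[OF sub that]] p(2) uv(3) by simp
  have "(a, u) \<in> (edge_rel covered)\<^sup>*"
    using a by (intro symD[OF sym_rtrancl_edge_rel reach]) simp
  then have "u \<in> component x" by (rule component_trans[OF x])
  then show ?thesis using reach component_trans by (intro subsetI) metis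
qed

definition component_edges :: "nat \<Rightarrow> nat set set" where
  "component_edges x = {e \<in> NT. e \<subseteq> component x}"

lemma component_edges_subset: "component_edges x \<subseteq> NT"
  by (auto simp: component_edges_def)

text \<open>Vertices of a component are linked by covered paths, and each edge on such a path comes
  from a cycle within the same component. Acyclicity is inherited from \<open>T\<close>.\<close>

lemma component_edges_ok: "fund_collection_ok E T (component_edges x)"
proof -
  let ?F = "fsum T (component_edges x) \<inter> T"
  have F: "?F = (\<Union>e\<in>component_edges x. parent_edge ` tree_span e)"
    by (rule fsum_Int_T[OF component_edges_subset])
  have FK: "y \<in> component x" if y: "y \<in> \<Union> ?F" for y
  proof -
    obtain e where e: "e \<in> NT" "e \<subseteq> component x" "y \<in> \<Union> (parent_edge ` tree_span e)"
      using y[unfolded F] unfolding component_edges_def by blast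
    obtain a where "a \<in> e" using NT_E[OF e(1)] edgeE by blast
    then show ?thesis using fund_cycle_component[OF e(1)] e(2,3) by blast
  qed
  have connect: "z \<in> component x \<and> (y, z) \<in> (edge_rel ?F)\<^sup>*"
    if "(y, z) \<in> (edge_rel covered)\<^sup>*" and y: "y \<in> component x" for y z
    using that(1)
  proof (induction rule: rtrancl_induct)
    case base
    then show ?case using y by simp
  next
    case (step b c)
    obtain e where e: "e \<in> NT" "{b, c} \<in> parent_edge ` tree_span e"
      using step(2) unfolding edge_rel_def covered_def by blast
    have "b \<in> component x" using step.IH by simp
    then have "e \<union> \<Union> (parent_edge ` tree_span e) \<subseteq> component x"
      using fund_cycle_component[OF e(1), of b] e(2) by blast
    then have "e \<in> component_edges x" "c \<in> component x"
      using e unfolding component_edges_def by auto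
    then have "(b, c) \<in> edge_rel ?F" using e(2) unfolding F edge_rel_def by blast
    then show ?case using step.IH \<open>c \<in> component x\<close> by (blast intro: rtrancl_into_rtrancl)
  qed
  have "connected_on (\<Union> ?F) ?F"
    unfolding connected_on_def
  proof (intro ballI)
    fix y z assume yz: "y \<in> \<Union> ?F" "z \<in> \<Union> ?F"
    then have "(y, z) \<in> (edge_rel ?F)\<^sup>*"
      using connect[OF component_connected] FK by blast
    then obtain xs where xs: "vpath ?F xs" "hd xs = y" "last xs = z"
      using rtrancl_edge_rel_vpath by blast
    then have "set xs \<subseteq> \<Union> ?F" using vpath_set_subset yz(1) by blast
    then show "\<exists>xs. vpath ?F xs \<and> hd xs = y \<and> last xs = z \<and> set xs \<subseteq> \<Union> ?F"
      using xs by blast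
  qed
  moreover have "acyclic_edges ?F"
    unfolding acyclic_edges_def
  proof (intro allI impI, elim conjE)
    fix xs ys assume "vpath ?F xs" "vpath ?F ys" "hd xs = hd ys" "last xs = last ys"
    moreover from this have "vpath T xs" "vpath T ys" by (auto simp: vpath_iff)
    ultimately show "xs = ys" using tpath_eq by metis
  qed
  ultimately show ?thesis
    unfolding fund_collection_ok_def subtree_edges_def using component_edges_subset by blast
qed

text \<open>In a larger admissible collection, the tree part of an additional cycle would be joined
  by covered edges to a cycle of the component, which would pull its edge into the component.
  Nonemptiness provides the cycle to join to.\<close>

lemma component_edges_maximal:
  assumes ne: "component_edges x \<noteq> {}"
  shows "maximal_fund_collection E T (component_edges x)"
  unfolding maximal_fund_collection_def
proof (intro conjI allI impI component_edges_ok notI)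
  fix S assume sub: "component_edges x \<subset> S" and ok: "fund_collection_ok E T S"
  let ?F = "fsum T S \<inter> T"
  have S: "S \<subseteq> NT" and conn: "connected_on (\<Union> ?F) ?F"
    using ok by (auto simp: fund_collection_ok_def subtree_edges_def)
  have F: "?F = (\<Union>e\<in>S. parent_edge ` tree_span e)" by (rule fsum_Int_T[OF S])
  have cov: "?F \<subseteq> covered" using S unfolding F covered_def by blast
  \<comment> \<open>With \<open>W\<close> taken to be \<open>e\<close> itself, the nonempty trace
    shows that the cycle has a tree edge.\<close>
  have endpoint: "\<exists>a. a \<in> \<Union> (parent_edge ` tree_span e)" if "e \<in> S" for e
    using that S tree_span_trace_nonempty[of e e] NT_E[of e] unfolding parent_edge_def by blast
  obtain f where f: "f \<in> component_edges x" using ne by blast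
  obtain e where e: "e \<in> S" "e \<notin> component_edges x" using sub by blast
  obtain a where a: "a \<in> \<Union> (parent_edge ` tree_span f)" using endpoint f sub by blast
  obtain b where b: "b \<in> \<Union> (parent_edge ` tree_span e)" using endpoint e by blast
  have "a \<in> \<Union> ?F" "b \<in> \<Union> ?F" using a b e f sub unfolding F by blast+
  then obtain xs where xs: "vpath ?F xs" "hd xs = a" "last xs = b"
    using conn unfolding connected_on_def by blast
  then have "(a, b) \<in> (edge_rel covered)\<^sup>*"
    using path_edges_rtrancl[OF order_trans[OF _ cov], of xs b] by (auto simp: vpath_iff)
  moreover have "a \<in> component x"
  proof -
    have fN: "f \<in> NT" "f \<subseteq> component x" using f by (auto simp: component_edges_def)
    obtain c where "c \<in> f" using NT_E[OF fN(1)] edgeE by blast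
    then show ?thesis using fund_cycle_component[OF fN(1)] fN(2) a by blast
  qed
  ultimately have "b \<in> component x" using component_trans by blast
  then have "e \<subseteq> component x" using fund_cycle_component[of e b x] b e(1) S by blast
  then show False using e S unfolding component_edges_def by blast
qed

text \<open>A shallowest vertex \<open>w\<close> of \<open>W\<close> in the component is never
  recorded, since a recorded vertex lies strictly below the upper end of an edge inside
  \<open>W\<close>. This absorbs the \<open>+ 1\<close> of the DEP count.\<close>

lemma card_inside_component:
  assumes dep: "\<And>S. maximal_fund_collection E T S \<Longrightarrow> DEP T S"
    and fin: "finite W" and W: "W \<subseteq> {..<n}"
  shows "card (inside W (component_edges x)) \<le> card (component x \<inter> W)"
proof (cases "inside W (component_edges x) = {}")
  case False
  then have dep: "DEP T (component_edges x)"
    by (intro dep component_edges_maximal) (auto simp: inside_def)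
  obtain e where e: "e \<in> NT" "e \<subseteq> component x \<inter> W"
    using False unfolding inside_def component_edges_def by auto
  obtain a where "a \<in> e" using NT_E[OF e(1)] edgeE by blast
  then have "a \<in> component x \<inter> W" using e by blast
  then obtain w where w: "w \<in> component x \<inter> W"
    and min: "\<And>y. y \<in> component x \<inter> W \<Longrightarrow> depth w \<le> depth y"
    using ex_has_least_nat[of "\<lambda>y. y \<in> component x \<inter> W" a depth] by blast
  have "spanned W (component_edges x) \<subseteq> component x \<inter> W - {w}"
  proof
    fix z assume "z \<in> spanned W (component_edges x)"
    then obtain f where f: "f \<in> NT" "f \<subseteq> component x \<inter> W" "z \<in> tree_span f" "z \<in> W"
      unfolding spanned_def inside_def component_edges_def by auto
    obtain u v where uv: "f = {u, v}" "u < n" "v < n" "u \<prec> v"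
      using edge_orientE[OF NT_E[OF f(1)]] by metis
    have "z \<in> \<Union> (parent_edge ` tree_span f)" using f(3) by (auto simp: parent_edge_def)
    then have "z \<in> component x"
      using fund_cycle_component[OF f(1), of u x] uv(1) f(2) by blast
    moreover have "u \<prec> z" using f(3) tree_span_eq[OF uv(3,4)] uv(1) by auto
    then have "depth u < depth z" using depth_less W f(4) by blast
    then have "z \<noteq> w" using min[of u] uv(1) f(2) by auto
    ultimately show "z \<in> component x \<inter> W - {w}" using f(4) by blast
  qed
  then have "card (spanned W (component_edges x)) \<le> card (component x \<inter> W - {w})"
    using fin by (intro card_mono) auto
  also have "\<dots> < card (component x \<inter> W)"
    using w fin by (intro card_Diff1_less) auto
  finally show ?thesis
    using card_inside_DEP[OF fin component_edges_subset dep] by simp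
qed simp

text \<open>Every non-tree edge inside \<open>W\<close> lies in the component of its endpoints, and
  the traces of distinct components on \<open>W\<close> are disjoint, so the bounds add up to
  \<open>card W\<close>.\<close>

lemma card_inside_NT:
  assumes dep: "\<And>S. maximal_fund_collection E T S \<Longrightarrow> DEP T S"
    and W: "W \<subseteq> {..<n}"
  shows "card (inside W NT) \<le> card W"
proof -
  have fin: "finite W" using W finite_subset by blast
  let ?C = "component ` W"
  \<comment> \<open>\<open>component_edges\<close> takes a vertex, so each component needs one
    chosen representative to be summed over only once.\<close>
  define rep where "rep K = (SOME x. component x = K)" for K
  have rep: "component (rep K) = K" if "K \<in> ?C" for K
    using that unfolding rep_def by (metis (mono_tags) imageE someI)
  have "inside W NT \<subseteq> (\<Union>K\<in>?C. inside W (component_edges (rep K)))"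
  proof
    fix e assume e: "e \<in> inside W NT"
    then have eN: "e \<in> NT" "e \<subseteq> W" by (auto simp: inside_def)
    obtain a where a: "a \<in> e" using NT_E[OF eN(1)] edgeE by blast
    then have "a \<in> W" using eN by blast
    moreover have "e \<subseteq> component a"
      using fund_cycle_component[OF eN(1), of a a] a in_component by blast
    ultimately show "e \<in> (\<Union>K\<in>?C. inside W (component_edges (rep K)))"
      using eN rep by (auto simp: inside_def component_edges_def)
  qed
  moreover have "finite (inside W (component_edges y))" for y
    using finite_subset[OF _ finite_NT] component_edges_subset
    by (metis (no_types, lifting) inside_def mem_Collect_eq subset_iff)
  ultimately have "card (inside W NT) \<le> card (\<Union>K\<in>?C. inside W (component_edges (rep K)))"
    using fin by (intro card_mono) auto
  also have "\<dots> \<le> (\<Sum>K\<in>?C. card (inside W (component_edges (rep K))))"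
    using fin by (intro card_UN_le) auto
  also have "\<dots> \<le> (\<Sum>K\<in>?C. card (K \<inter> W))"
    using card_inside_component[OF dep fin W] rep by (intro sum_mono) metis
  also have "\<dots> = card (\<Union>K\<in>?C. K \<inter> W)"
  proof (rule card_UN_disjoint[symmetric])
    show "\<forall>K\<in>?C. \<forall>L\<in>?C. K \<noteq> L \<longrightarrow> (K \<inter> W) \<inter> (L \<inter> W) = {}"
      using component_eqI by blast
  qed (use fin in auto)
  also have "\<dots> \<le> card W" using fin by (intro card_mono) auto
  finally show ?thesis .
qed

section \<open>Tree edges inside a vertex set, and the colouring\<close>

lemma card_inside_T:
  assumes W: "W \<subseteq> {..<n}" "W \<noteq> {}"
  shows "card (inside W T) < card W"
proof -
  have fin: "finite W" using W finite_subset by blast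
  obtain w where w: "w \<in> W" and min: "\<And>y. y \<in> W \<Longrightarrow> depth w \<le> depth y"
    using ex_has_least_nat[of "\<lambda>y. y \<in> W" _ depth] W(2) by blast
  \<comment> \<open>Each tree edge inside \<open>W\<close> is the parent edge of its lower end,
    which lies below another vertex of \<open>W\<close> and so differs from the shallowest vertex
    \<open>w\<close>.\<close>
  have "inside W T \<subseteq> parent_edge ` (W - {w})"
  proof
    fix e assume "e \<in> inside W T"
    then have e: "e \<in> T" "e \<subseteq> W" by (auto simp: inside_def)
    obtain u v where uv: "e = {u, v}" "u < n" "v < n" "u \<prec> v"
      using edge_orientE[of e] T_subset e(1) by blast
    \<comment> \<open>By uniqueness \<open>[u, v]\<close> is the whole tree path, so
      \<open>parent_edge v\<close>, one of its edges, must be \<open>e\<close>.\<close>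
    have "vpath T [u, v]" using e(1) uv by (simp add: vpath_iff)
    from tpath_eq[OF this] have "path_edges (tpath T u v) = {e}" using uv(1) by simp
    moreover have "parent_edge v \<in> path_edges (tpath T u v)"
      using path_edges_tpath[OF uv(3)] uv(4) le_refl[OF uv(3)] by blast
    ultimately have "parent_edge v = e" by simp
    moreover have "v \<noteq> w" using min[of u] depth_less[OF uv(3,4)] e(2) uv(1) by auto
    ultimately show "e \<in> parent_edge ` (W - {w})" using e(2) uv(1) by blast
  qed
  then have "card (inside W T) \<le> card (W - {w})"
    using fin by (intro surj_card_le) auto
  then show ?thesis using card_Diff1_less[OF fin w] by simp
qed

text \<open>Tree and non-tree edges inside \<open>W\<close> together number fewer than
  \<open>2 * card W\<close>, so the handshake count with \<open>d = 2\<close> yields a vertex of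
  degree at most 3.\<close>

lemma four_colouring:
  assumes dep: "\<And>S. maximal_fund_collection E T S \<Longrightarrow> DEP T S"
  shows "\<exists>c :: nat \<Rightarrow> nat. (\<forall>x. c x < 4) \<and>
    (\<forall>x\<in>{..<n}. \<forall>y\<in>{..<n}. x \<noteq> y \<longrightarrow> {x, y} \<in> E \<longrightarrow> c x \<noteq> c y)"
proof (rule degenerate_four_colouring)
  fix W assume W: "W \<subseteq> {..<n}" "W \<noteq> {}"
  have "{e \<in> E. e \<subseteq> W} = inside W T \<union> inside W NT"
    using T_subset by (auto simp: inside_def nontree_edges_def)
  then have "card {e \<in> E. e \<subseteq> W} \<le> card (inside W T) + card (inside W NT)"
    by (simp add: card_Un_le)
  also have "\<dots> < 2 * card W"
    using card_inside_T[OF W] card_inside_NT[OF dep W(1)] by simp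
  finally have "\<exists>w\<in>W. card {y \<in> W. {w, y} \<in> E} < 2 * 2"
    using exists_low_degree[of W E 2] W card_edge finite_subset by blast
  then show "\<exists>w\<in>W. card {y \<in> W. {w, y} \<in> E} \<le> 3" by (elim bexE, intro bexI) auto
qed simp

end

section \<open>From the colouring to the spectral bound\<close>

theorem theorem5p2:
  fixes n :: nat and E :: "nat set set" and \<phi> :: "nat \<Rightarrow> nat \<Rightarrow> complex"
  assumes "connected_graph n E"
    and "EDEP n E"
    and "T_gain E \<phi>"
  shows "lambda1 (gain_adj n E \<phi>) \<le> spectral_radius (gain_adj n E \<phi>) \<and>
         spectral_radius (gain_adj n E \<phi>) \<le> 3 * lambda1 (gain_adj n E \<phi>)"
proof -
  let ?A = "gain_adj n E \<phi>"
  have A: "?A \<in> carrier_mat n n" by (simp add: gain_adj_def)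
  have n: "n > 0" and simple: "simple_graph n E"
    using assms(1) by (auto simp: connected_graph_def)
  have herm: "mat_adjoint ?A = ?A" by (rule T_gain_self_adjoint[OF assms(3)])
  obtain T r where nst: "normal_spanning_tree n E T r"
    and dep: "\<And>S. maximal_fund_collection E T S \<Longrightarrow> DEP T S"
    using assms(2) unfolding EDEP_def by blast
  interpret normal_tree n E T r by unfold_locales (fact simple nst)+
  obtain c :: "nat \<Rightarrow> nat" where col: "\<And>x. c x < 4"
    and proper: "\<And>x y. x < n \<Longrightarrow> y < n \<Longrightarrow> x \<noteq> y \<Longrightarrow> {x, y} \<in> E \<Longrightarrow> c x \<noteq> c y"
    using four_colouring[OF dep] by auto
  have "?A $$ (i, j) = 0" if "i < n" "j < n" "c i = c j" for i j
    \<comment> \<open>Distinct vertices of equal colour are not adjacent, and the diagonal vanishes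
      because there are no loops.\<close>
    using that proper[OF that(1,2)] edge_less[of i j] by (auto simp: gain_adj_def)
  then have "spectral_radius ?A \<le> 3 * lambda1 ?A"
    by (rule spectral_radius_le_lambda1_of_four_colouring[OF A n herm col])
  then show ?thesis using lambda1_le_spectral_radius[OF A n herm] by simp
qed

end
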